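(* Suppose that the singular integral operator $T$ is associated with a kernel $K(x,y)$ in the sense that $$T(f)(x)=\int_{\mathbf R^n}K(x,y)f(y)\,dy\qquad\text{for } x\notin\operatorname{supp} f,$$ whenever $f$ is compactly supported. Assume that there exist two constants $A,A'>0$ and $1<r<\infty$ so that (i) $|K(x,y)|\le A|x-y|^{-n}$ uniformly for $x\ne y$, (ii) $\int_{|x-y|\ge2|y-y'|}|K(x,y)-K(x,y')|\,dx\le A'$ uniformly for $y,y'\in\mathbf R^n$, (iii) $T$ is bounded from $L^{r,1}(\mathbf R^n)$ to $L^{r,\infty}(\mathbf R^n)$. Then $T$ admits an extension that is of weak-type $(1,1)$ with a bound proportional to $A'+\|T\|_{L^{r,1}\to L^{r,\infty}}$.
   Context: $\mathbf R^n$ carries Lebesgue measure. $T$ is a singular integral operator, i.e. a linear operator, defined on $L^{r,1}(\mathbf R^n)$ with values in measurable functions; the kernel representation is for compactly supported $f$ in the domain of $T$. Decreasing rearrangement: $f^*(t)=\inf\{s>0:|\{|f|>s\}|\le t\}$ for $t\ge0$. The Lorentz space $L^{p,q}(\mathbf R^n)$, $0<p,q\le\infty$, consists of all complex-valued measurable $f$ with finite quasi-norm $\|f\|_{L^{p,q}}=\left(\int_0^\infty (t^{1/p}f^*(t))^q\,\frac{dt}{t}\right)^{1/q}$ if $q<\infty$ and $\|f\|_{L^{p,\infty}}=\sup_{t>0}t^{1/p}f^*(t)$. $\|T\|_{L^{r,1}\to L^{r,\infty}}$ is the least constant $C$ with $\|T(f)\|_{L^{r,\infty}}\le C\|f\|_{L^{r,1}}$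 for all $f\in L^{r,1}(\mathbf R^n)$. An operator is of weak-type $(1,1)$ with bound $B$ if $\|T(f)\|_{L^{1,\infty}(\mathbf R^n)}\le B\|f\|_{L^1(\mathbf R^n)}$ for all $f\in L^1(\mathbf R^n)$. The extension is an operator on $L^1(\mathbf R^n)$ agreeing with $T$ on $L^1(\mathbf R^n)\cap L^{r,1}(\mathbf R^n)$. "Proportional" means at most a constant multiple, the constant not depending on $T$, $K$, $A$ or $A'$. *)

theory Defs
  imports "HOL-Analysis.Analysis"
begin

text \<open>Elements of the function spaces below are represented by functions on \<open>real ^ 'n\<close>;
  operators are applied to representatives and are compared almost everywhere.\<close>

text \<open>Takes the value \<open>\<infinity>\<close> (the infimum of the empty set) if no real \<open>s > 0\<close> qualifies.\<close>

definition decr_rearr :: "(real ^ 'n::finite \<Rightarrow> complex) \<Rightarrow> real \<Rightarrow> ennreal" where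
  "decr_rearr f t =
     Inf {ennreal s |s. s > 0 \<and> emeasure lebesgue {x. norm (f x) > s} \<le> ennreal t}"

text \<open>Real powers on \<open>[0, \<infinity>]\<close>, used for exponents \<open>a > 0\<close> only.\<close>

definition ennreal_pow :: "ennreal \<Rightarrow> real \<Rightarrow> ennreal" where
  "ennreal_pow x a = (if x = \<infinity> then \<infinity> else ennreal (enn2real x powr a))"

text \<open>The exponents range over \<open>0 < p, q \<le> \<infinity>\<close>. For \<open>p = \<infinity>\<close> the exponent \<open>1 / p\<close> is \<open>0\<close>.\<close>

definition lorentz_norm :: "ennreal \<Rightarrow> ennreal \<Rightarrow> (real ^ 'n::finite \<Rightarrow> complex) \<Rightarrow> ennreal" where
  "lorentz_norm p q f =
     (if q = \<infinity> then (SUP t\<in>{0<..}. ennreal (t powr enn2real (1 / p)) * decr_rearr f t)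
      else ennreal_pow
        (\<integral>\<^sup>+ t\<in>{0<..}. ennreal_pow (ennreal (t powr enn2real (1 / p)) * decr_rearr f t) (enn2real q)
                       * ennreal (1 / t) \<partial>lborel)
        (1 / enn2real q))"

definition lorentz_space :: "ennreal \<Rightarrow> ennreal \<Rightarrow> (real ^ 'n::finite \<Rightarrow> complex) set" where
  "lorentz_space p q = {f \<in> borel_measurable lebesgue. lorentz_norm p q f < \<infinity>}"

definition L1_space :: "(real ^ 'n::finite \<Rightarrow> complex) set" where
  "L1_space = {f. integrable lebesgue f}"

text \<open>A linear map from \<open>V\<close> to the measurable functions, both taken modulo equality almost
  everywhere. The values of \<open>T\<close> outside \<open>V\<close> are irrelevant.\<close>

definition linear_operator_on ::
  "(real ^ 'n::finite \<Rightarrow> complex) set \<Rightarrow> ((real ^ 'n \<Rightarrow> complex) \<Rightarrow> (real ^ 'n \<Rightarrow> complex)) \<Rightarrow> bool" where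
  "linear_operator_on V T \<longleftrightarrow>
     (\<forall>f\<in>V. T f \<in> borel_measurable lebesgue) \<and>
     (\<forall>f\<in>V. \<forall>g\<in>V. (AE x in lebesgue. f x = g x) \<longrightarrow> (AE x in lebesgue. T f x = T g x)) \<and>
     (\<forall>f\<in>V. \<forall>g\<in>V. AE x in lebesgue. T (\<lambda>y. f y + g y) x = T f x + T g x) \<and>
     (\<forall>f\<in>V. \<forall>c. AE x in lebesgue. T (\<lambda>y. c * f y) x = c * T f x)"

text \<open>The least constant \<open>C\<close> with \<open>\<parallel>T f\<parallel> \<le> C \<parallel>f\<parallel>\<close>; it is \<open>\<infinity>\<close> if and only if \<open>T\<close> is unbounded.\<close>

definition lorentz_opnorm :: "ennreal \<Rightarrow> ennreal \<Rightarrow> ennreal \<Rightarrow> ennreal \<Rightarrow>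
    ((real ^ 'n::finite \<Rightarrow> complex) \<Rightarrow> (real ^ 'n \<Rightarrow> complex)) \<Rightarrow> ennreal" where
  "lorentz_opnorm p q p' q' T =
     Inf {ennreal C |C. C \<ge> 0 \<and>
       (\<forall>f\<in>lorentz_space p q. lorentz_norm p' q' (T f) \<le> ennreal C * lorentz_norm p q f)}"

definition weak_type_1_1 ::
  "((real ^ 'n::finite \<Rightarrow> complex) \<Rightarrow> (real ^ 'n \<Rightarrow> complex)) \<Rightarrow> ennreal \<Rightarrow> bool" where
  "weak_type_1_1 T B \<longleftrightarrow>
     (\<forall>f\<in>L1_space. lorentz_norm 1 \<infinity> (T f) \<le> B * (\<integral>\<^sup>+ x. ennreal (norm (f x)) \<partial>lebesgue))"

text \<open>The kernel is a measurable function off the diagonal; its values on the diagonal are never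
  used. Since \<open>T\<close> only sees \<open>f\<close> modulo null sets, using the closure of \<open>{y. f y \<noteq> 0}\<close> for all
  representatives \<open>f\<close> amounts to using the essential support.\<close>

definition associated_kernel :: "(real ^ 'n::finite \<Rightarrow> complex) set \<Rightarrow>
    ((real ^ 'n \<Rightarrow> complex) \<Rightarrow> (real ^ 'n \<Rightarrow> complex)) \<Rightarrow>
    (real ^ 'n \<Rightarrow> real ^ 'n \<Rightarrow> complex) \<Rightarrow> bool" where
  "associated_kernel V T K \<longleftrightarrow>
     (\<lambda>(x, y). K x y) \<in> borel_measurable (lebesgue_on {(x, y). x \<noteq> y}) \<and>
     (\<forall>f\<in>V. compact (closure {y. f y \<noteq> 0}) \<longrightarrow>
        (AE x in lebesgue. x \<notin> closure {y. f y \<noteq> 0} \<longrightarrow>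
           T f x = (\<integral>y. K x y * f y \<partial>lebesgue)))"

definition size_condition :: "(real ^ 'n::finite \<Rightarrow> real ^ 'n \<Rightarrow> complex) \<Rightarrow> real \<Rightarrow> bool" where
  "size_condition K A \<longleftrightarrow>
     (\<forall>x y. x \<noteq> y \<longrightarrow> norm (K x y) \<le> A / norm (x - y) ^ CARD('n))"

text \<open>The measurability clause says that the integral is meaningful for every pair \<open>y\<close>, \<open>y'\<close>;
  joint measurability of \<open>K\<close> would only give this for almost every pair.\<close>

definition hoermander_condition :: "(real ^ 'n::finite \<Rightarrow> real ^ 'n \<Rightarrow> complex) \<Rightarrow> real \<Rightarrow> bool" where
  "hoermander_condition K A' \<longleftrightarrow>
     (\<forall>y y'. let S = {x. norm (x - y) \<ge> 2 * norm (y - y')} in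
        (\<lambda>x. K x y - K x y') \<in> borel_measurable (lebesgue_on S) \<and>
        (\<integral>\<^sup>+ x. ennreal (norm (K x y - K x y')) \<partial>lebesgue_on S) \<le> ennreal A')"

end

theory Submission
  imports Defs
begin

text \<open>
  Calderon-Zygmund decomposition, carried out only for functions that are constant on the cubes of
  a fine dyadic grid. For such a function the stopping cubes are finitely many and the good part is
  bounded without Lebesgue differentiation, and \<open>T\<close> is applied to a finite sum. With level
  \<open>\<lambda> / D\<close>, \<open>D = A' + B\<close>, where \<open>B\<close> is a Lorentz bound of \<open>T\<close>, the good part \<open>g\<close> satisfies
  \<open>g\<^sup>*(t) \<le> min M (L / t)\<close>, hence has \<open>L\<^bsup>r,1\<^esup>\<close> norm at most \<open>c M\<^bsup>1-1/r\<^esup> L\<^bsup>1/r\<^esup>\<close>; the bad parts have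
  mean zero, so Hoermander's condition controls them off the dilated cubes. The resulting estimate
  \<open>|{|T s| > \<lambda>}| \<le> c \<parallel>s\<parallel>\<^sub>1 / \<lambda>\<close> on step functions extends by density: the value at \<open>f\<close> is
  characterised by \<open>|{|u - T s| > \<lambda>}| \<le> c \<parallel>f - s\<parallel>\<^sub>1 / \<lambda>\<close> for all \<open>s\<close>. It agrees with \<open>T f\<close> on
  \<open>L\<^sup>1 \<inter> L\<^bsup>r,1\<^esup>\<close> because step functions approximate \<open>f\<close> in \<open>L\<^sup>1\<close> while their images converge to
  \<open>T f\<close> in measure.
\<close>

section \<open>Decreasing rearrangements and Lorentz norms\<close>

text \<open>The operator is additive only for finitely many summands and only almost everywhere, and
  the kernel formula concerns single functions with compact support. An infinite sum of bad parts
  would need a convergence argument for its image before any estimate; a fixed mesh bounds the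
  stopping cubes from below in size, hence in number. The height \<open>l / D\<close> balances three
  costs. Up to constants the good part contributes
  \<open>D powr r * height powr (r - 1) * L / l powr r\<close>, the dilated cubes
  \<open>L / height\<close>, the bad parts \<open>A' * L / l\<close>, where \<open>L\<close> is the
  mass of the step function; all are then bounded by multiples of \<open>D * L / l\<close>. The
  kernel is jointly measurable only for the completed measure, so its individual slices may fail to
  be measurable. They are compared with slices of a Borel function, which forces the base point of
  the cancellation to be picked from almost every, not every, point of a cube.\<close>

lemma enn2real_inverse_ennreal: "r > 0 \<Longrightarrow> enn2real (1 / ennreal r) = 1 / r"
  by (metis divide_ennreal enn2real_ennreal ennreal_1 less_eq_real_def zero_le_divide_1_iff zero_le_one)

lemma level_set_measurable:
  fixes f :: "'a::euclidean_space \<Rightarrow> complex"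
  shows "f \<in> borel_measurable lebesgue \<Longrightarrow> {x. norm (f x) > s} \<in> sets lebesgue"
proof -
  assume [measurable]: "f \<in> borel_measurable lebesgue"
  have "{x \<in> space lebesgue. norm (f x) > s} \<in> sets lebesgue" by measurable
  then show ?thesis by simp
qed

lemma decr_rearr_le:
  assumes "s > 0" "emeasure lebesgue {x. norm (f x) > s} \<le> ennreal t"
  shows "decr_rearr f t \<le> ennreal s"
  unfolding decr_rearr_def by (rule Inf_lower) (use assms in auto)

lemma decr_rearr_mono:
  assumes "\<And>s. s > 0 \<Longrightarrow> emeasure lebesgue {x. norm (f x) > s} \<le> emeasure lebesgue {x. norm (g x) > s}"
  shows "decr_rearr f t \<le> decr_rearr g t"
  unfolding decr_rearr_def by (rule Inf_superset_mono) (use assms order_trans in blast)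

lemma decr_rearr_antimono: "t \<le> t' \<Longrightarrow> decr_rearr f t' \<le> decr_rearr f t"
  unfolding decr_rearr_def
  by (rule Inf_superset_mono) (use ennreal_leI order_trans in blast)

lemma decr_rearr_ge:
  assumes f: "f \<in> borel_measurable lebesgue" and lt: "ennreal t < emeasure lebesgue {x. norm (f x) > s}"
  shows "ennreal s \<le> decr_rearr f t"
  unfolding decr_rearr_def
proof (rule Inf_greatest)
  fix u assume "u \<in> {ennreal s |s. s > 0 \<and> emeasure lebesgue {x. norm (f x) > s} \<le> ennreal t}"
  then obtain s' where s': "u = ennreal s'" "0 < s'" "emeasure lebesgue {x. s' < norm (f x)} \<le> ennreal t"
    by auto
  show "ennreal s \<le> u" unfolding s'(1)
  proof (rule ccontr)
    assume "\<not> ennreal s \<le> ennreal s'"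
    then have "s' \<le> s" by (metis ennreal_leI linear)
    note [measurable] = level_set_measurable[OF f]
    have "emeasure lebesgue {x. norm (f x) > s} \<le> emeasure lebesgue {x. s' < norm (f x)}"
      by (rule emeasure_mono) (use \<open>s' \<le> s\<close> in auto)
    with s' lt show False by (meson leD order_trans)
  qed
qed

text \<open>Monotonicity in \<open>t\<close> makes every superlevel set an interval. Measurability
  is what later allows dominated convergence inside the Lorentz integral.\<close>

lemma borel_measurable_decr_rearr [measurable]: "decr_rearr f \<in> borel_measurable borel"
proof (rule borel_measurableI_greater)
  fix y
  have "is_interval {t. y < decr_rearr f t}"
    unfolding is_interval_1 using decr_rearr_antimono less_le_trans by blast
  then have "{t. y < decr_rearr f t} \<in> sets borel"
    using is_real_interval by (metis borel_closed borel_open closed_UNIV closed_atLeast closed_atMost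
       closed_atLeastAtMost open_greaterThan open_lessThan open_greaterThanLessThan sets.empty_sets 
        atLeastLessThan_borel greaterThanAtMost_borel)
  then show "{x \<in> space borel. y < decr_rearr f x} \<in> sets borel" by simp
qed

text \<open>Chebyshev's inequality for the weak space: testing the supremum at one \<open>t\<close>
  below the measure of the level set forces \<open>t powr (1 / r) * s\<close> to be at most
  \<open>W\<close>.\<close>

lemma emeasure_le_of_weak_lorentz:
  assumes f: "f \<in> borel_measurable lebesgue" and "r > 0" "s > 0" "W \<ge> 0"
    and W: "lorentz_norm (ennreal r) \<infinity> f \<le> ennreal W"
  shows "emeasure lebesgue {x. norm (f x) > s} \<le> ennreal ((W / s) powr r)"
proof (rule ccontr)
  assume "\<not> ?thesis"
  then have "ennreal ((W / s) powr r) < emeasure lebesgue {x. norm (f x) > s}" by simp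
  \<comment> \<open>An intermediate value is finite even if the level set has infinite
    measure.\<close>
  then obtain t' where t': "ennreal ((W / s) powr r) < t'" "t' < emeasure lebesgue {x. norm (f x) > s}"
    using dense by blast
  then obtain t where t: "t' = ennreal t" "t \<ge> 0" by (cases t') auto
  have tt: "(W / s) powr r < t" using t' t by (simp add: ennreal_less_iff)
  then have "t > 0" by (smt (verit) powr_ge_zero)
  have "ennreal (t powr (1 / r)) * ennreal s \<le> ennreal (t powr (1 / r)) * decr_rearr f t"
    by (rule mult_left_mono) (use decr_rearr_ge[OF f] t t' in auto)
  also have "\<dots> \<le> lorentz_norm (ennreal r) \<infinity> f"
    unfolding lorentz_norm_def using \<open>t > 0\<close> enn2real_inverse_ennreal[OF \<open>r > 0\<close>]
    by (auto intro!: SUP_upper2[of t])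
  also note W
  finally have "ennreal (t powr (1 / r) * s) \<le> ennreal W" by (simp add: ennreal_mult')
  then have "t powr (1/r) \<le> W / s" using assms by (simp add: field_simps)
  then have "(t powr (1/r)) powr r \<le> (W / s) powr r" using assms by (intro powr_mono2) auto
  then show False using tt \<open>t > 0\<close> \<open>r > 0\<close> by (simp add: powr_powr)
qed

lemma weak_lorentz_one_le:
  assumes "B \<ge> 0" "\<And>s. s > 0 \<Longrightarrow> emeasure lebesgue {x. norm (f x) > s} \<le> ennreal (B / s)"
  shows "lorentz_norm 1 \<infinity> f \<le> ennreal B"
proof -
  have "ennreal t * decr_rearr f t \<le> ennreal B" if "t > 0" for t
  proof (rule ennreal_le_epsilon)
    \<comment> \<open>The slack \<open>e\<close> keeps the level \<open>(B + e) / t\<close> positive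
      when \<open>B = 0\<close>, as the infimum in \<open>decr_rearr\<close> ranges over positive
      levels only.\<close>
    fix e :: real assume "e > 0"
    have "decr_rearr f t \<le> ennreal ((B + e) / t)"
    proof (rule decr_rearr_le)
      show "(B + e) / t > 0" using \<open>e > 0\<close> \<open>t > 0\<close> assms by simp
      then have "emeasure lebesgue {x. norm (f x) > (B + e) / t} \<le> ennreal (B / ((B + e) / t))"
        by (rule assms)
      also have "\<dots> \<le> ennreal t" 
        using \<open>e > 0\<close> \<open>t > 0\<close> assms(1) by (intro ennreal_leI) (simp add: field_simps)
      finally show "emeasure lebesgue {x. norm (f x) > (B + e) / t} \<le> ennreal t" .
    qed
    then have "ennreal t * decr_rearr f t \<le> ennreal t * ennreal ((B + e) / t)"
      by (rule mult_left_mono) auto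
    also have "\<dots> = ennreal B + ennreal e"
      using \<open>e > 0\<close> \<open>t > 0\<close> assms(1) by (simp flip: ennreal_mult ennreal_plus)
    finally show "ennreal t * decr_rearr f t \<le> ennreal B + ennreal e" .
  qed
  then show ?thesis unfolding lorentz_norm_def by (auto intro!: SUP_least)
qed

lemma lorentz_norm_one:
  assumes "r > 0"
  shows "lorentz_norm (ennreal r) 1 f =
    (\<integral>\<^sup>+ t\<in>{0<..}. ennreal (t powr (1 / r)) * decr_rearr f t * ennreal (1 / t) \<partial>lborel)"
proof -
  have "ennreal_pow x 1 = x" for x by (cases x) (auto simp: ennreal_pow_def)
  then show ?thesis using assms by (simp add: lorentz_norm_def enn2real_inverse_ennreal)
qed

section \<open>Size, finiteness and absolute continuity of the norm with second index 1\<close>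

lemma nn_integral_powr_from_0:
  assumes "a > -1" "c \<ge> 0"
  shows "(\<integral>\<^sup>+ t. ennreal (t powr a) * indicator {0..c} t \<partial>lborel) = ennreal (c powr (a + 1) / (a + 1))"
  by (rule nn_integral_has_integral_lebesgue'[OF _ has_integral_powr_from_0[OF assms]]) auto

lemma nn_integral_powr_to_inf:
  assumes "a < -1" "c > 0"
  shows "(\<integral>\<^sup>+ t. ennreal (t powr a) * indicator {c..} t \<partial>lborel) = ennreal (- (c powr (a + 1)) / (a + 1))"
  by (rule nn_integral_has_integral_lebesgue'[OF _ has_integral_powr_to_inf[OF assms]]) auto

lemma markov_norm:
  assumes f: "f \<in> borel_measurable lebesgue" and "s > 0" "(\<integral>\<^sup>+ x. ennreal (norm (f x)) \<partial>lebesgue) \<le> ennreal L"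
  shows "emeasure lebesgue {x. norm (f x :: complex) > s} \<le> ennreal (L / s)"
proof -
  have "{x. norm (f x) > s} \<subseteq> {x\<in>UNIV. 1 \<le> ennreal (1/s) * ennreal (norm (f x))}"
    using \<open>s > 0\<close> by (auto simp flip: ennreal_mult simp: field_simps)
  moreover have "{x\<in>space lebesgue. 1 \<le> ennreal (1/s) * ennreal (norm (f x))} \<in> sets lebesgue"
    using f by measurable
  ultimately have "emeasure lebesgue {x. norm (f x) > s} \<le> emeasure lebesgue {x\<in>UNIV. 1 \<le> ennreal (1/s) * ennreal (norm (f x))}"
    by (intro emeasure_mono) auto
  also have "\<dots> \<le> ennreal (1/s) * (\<integral>\<^sup>+ x. ennreal (norm (f x)) * indicator UNIV x \<partial>lebesgue)"
    using f by (intro nn_integral_Markov_inequality) auto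
  also have "\<dots> \<le> ennreal (1/s) * ennreal L" using assms by (intro mult_left_mono) auto
  also have "\<dots> = ennreal (L / s)" using \<open>s > 0\<close> by (simp flip: ennreal_mult')
  finally show ?thesis .
qed

text \<open>The bounds \<open>M\<close> and \<open>L / t\<close> for the rearrangement cross at
  \<open>t = L / M\<close>. Integrating them against \<open>t powr (1 / r - 1)\<close> below and
  above the crossing produces the summands \<open>r\<close> and \<open>r / (r - 1)\<close>; the tail
  converges because \<open>r > 1\<close>.\<close>

lemma lorentz_norm_one_le:
  assumes f: "f \<in> borel_measurable lebesgue" and r: "r > 1" and M: "M > 0" "\<And>x. norm (f x) \<le> M"
    and L: "L > 0" "(\<integral>\<^sup>+ x. ennreal (norm (f x)) \<partial>lebesgue) \<le> ennreal L"
  shows "lorentz_norm (ennreal r) 1 f \<le> ennreal ((r + r / (r - 1)) * M powr (1 - 1 / r) * L powr (1 / r))"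
proof -
  define c where "c = L / M"
  have c: "c > 0" using assms by (simp add: c_def)
  have "ennreal (t powr (1 / r)) * decr_rearr f t * ennreal (1 / t) * indicator {0<..} t \<le>
     ennreal M * (ennreal (t powr (1 / r - 1)) * indicator {0..c} t) + 
     ennreal L * (ennreal (t powr (1 / r - 2)) * indicator {c..} t)" for t
  proof (cases "t > 0")
    case True
    have e1: "{x. norm (f x) > M} = {}" using M by (auto simp: not_less)
    have 1: "decr_rearr f t \<le> ennreal M" 
      by (rule decr_rearr_le) (use M e1 in auto)
    have "emeasure lebesgue {x. norm (f x) > L / t} \<le> ennreal (L / (L / t))"
      using markov_norm[OF f _ L(2), of "L / t"] L True by simp
    then have 2: "decr_rearr f t \<le> ennreal (L / t)"
      using L True by (intro decr_rearr_le) auto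
    have p: "t powr (1/r) * (1/t) = t powr (1 / r - 1)" "t powr (1/r) * (L/t) * (1/t) = L * t powr (1 / r - 2)"
      using True by (simp_all add: powr_diff power2_eq_square)
    show ?thesis
    proof (cases "t \<le> c")
      case tc: True
      have "ennreal (t powr (1 / r)) * decr_rearr f t * ennreal (1 / t) \<le> ennreal (t powr (1 / r)) * ennreal M * ennreal (1 / t)"
        using 1 by (intro mult_left_mono mult_right_mono) auto
      also have "\<dots> = ennreal M * ennreal (t powr (1 / r - 1))"
        using p True M by (simp flip: ennreal_mult' ennreal_mult'' add: mult_ac)
      finally show ?thesis using True tc by (simp add: add_increasing2)
    next
      case tc: False
      have "ennreal (t powr (1 / r)) * decr_rearr f t * ennreal (1 / t) \<le> ennreal (t powr (1 / r)) * ennreal (L/t) * ennreal (1 / t)"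
        using 2 by (intro mult_left_mono mult_right_mono) auto
      also have "\<dots> = ennreal L * ennreal (t powr (1 / r - 2))"
        using p True L by (simp flip: ennreal_mult' ennreal_mult'')
      finally show ?thesis using True tc by simp
    qed
  qed auto
  then have "lorentz_norm (ennreal r) 1 f \<le> (\<integral>\<^sup>+ t. ennreal M * (ennreal (t powr (1 / r - 1)) * indicator {0..c} t) + 
     ennreal L * (ennreal (t powr (1 / r - 2)) * indicator {c..} t) \<partial>lborel)"
    using r by (subst lorentz_norm_one) (auto intro!: nn_integral_mono)
  also have "\<dots> = ennreal M * ennreal (c powr (1 / r - 1 + 1) / (1 / r - 1 + 1)) + 
      ennreal L * ennreal (- (c powr (1 / r - 2 + 1)) / (1 / r - 2 + 1))"
  proof (subst nn_integral_add)
    have "1 / r - 1 > -1" "1 / r - 2 < - 1" using r by (auto simp: field_simps)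
    then show "(\<integral>\<^sup>+ t. ennreal M * (ennreal (t powr (1 / r - 1)) * indicator {0..c} t) \<partial>lborel) + 
     (\<integral>\<^sup>+ t. ennreal L * (ennreal (t powr (1 / r - 2)) * indicator {c..} t) \<partial>lborel) =
      ennreal M * ennreal (c powr (1 / r - 1 + 1) / (1 / r - 1 + 1)) + 
      ennreal L * ennreal (- (c powr (1 / r - 2 + 1)) / (1 / r - 2 + 1))"
      using c by (subst (1 2) nn_integral_cmult) (auto simp only: nn_integral_powr_from_0 nn_integral_powr_to_inf less_imp_le, measurable)
  qed auto
  also have "\<dots> = ennreal (M * (c powr (1 / r) * r) + L * (c powr (1 / r - 1) * (r / (r - 1))))"
  proof -
    have a: "- (c powr (1 / r - 2 + 1)) / (1 / r - 2 + 1) = c powr (1 / r - 1) * (r / (r - 1))"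
      using r by (simp add: field_simps)
    have b: "c powr (1 / r - 1 + 1) / (1 / r - 1 + 1) = c powr (1 / r) * r" using r by simp
    have "ennreal M * ennreal X + ennreal L * ennreal Y = ennreal (M * X + L * Y)" if "X \<ge> 0" "Y \<ge> 0" for X Y
      using that M L by (simp add: ennreal_mult)
    then show ?thesis unfolding a b using r by simp
  qed
  also have "M * (c powr (1 / r) * r) + L * (c powr (1 / r - 1) * (r / (r - 1))) = (r + r / (r - 1)) * M powr (1 - 1 / r) * L powr (1 / r)"
  proof -
    have a: "M * c powr (1 / r) = M powr (1 - 1 / r) * L powr (1 / r)"
      using M L by (simp add: c_def powr_divide powr_diff)
    have b: "L * c powr (1 / r - 1) = M powr (1 - 1 / r) * L powr (1 / r)"
      using M L by (simp add: c_def powr_divide powr_diff)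
    have "M * (c powr (1 / r) * r) + L * (c powr (1 / r - 1) * (r / (r - 1))) = (M * c powr (1 / r)) * r + (L * c powr (1 / r - 1)) * (r / (r - 1))"
      by simp
    then show ?thesis unfolding a b by (simp add: algebra_simps)
  qed
  finally show ?thesis .
qed

text \<open>An infinite level set would keep the rearrangement at least \<open>s\<close> for every
  \<open>t\<close>, and the integral of \<open>s * t powr (1 / r - 1)\<close> over
  \<open>{0..c}\<close> is unbounded in \<open>c\<close>. Continuity of measure from above relies on
  this finiteness.\<close>

lemma emeasure_finite_of_lorentz:
  assumes f: "f \<in> borel_measurable lebesgue" and "r > 0" "lorentz_norm (ennreal r) 1 f < \<infinity>" "s > 0"
  shows "emeasure lebesgue {x. norm (f x) > s} < \<infinity>"
proof (rule ccontr)
  assume "\<not> ?thesis"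
  then have inf: "emeasure lebesgue {x. norm (f x) > s} = \<infinity>" by (metis infinity_ennreal_def top.not_eq_extremum)
  have ge: "ennreal s \<le> decr_rearr f t" for t
    by (rule decr_rearr_ge[OF f]) (simp add: inf)
  obtain w where w: "lorentz_norm (ennreal r) 1 f = ennreal w" "w \<ge> 0"
    using assms(3) by (cases "lorentz_norm (ennreal r) 1 f") auto
  have le: "s * (c powr (1 / r) * r) \<le> w" if "c > 0" for c
  proof -
    have "ennreal s * (ennreal (c powr (1 / r - 1 + 1) / (1 / r - 1 + 1))) =
       (\<integral>\<^sup>+ t. ennreal s * (ennreal (t powr (1 / r - 1)) * indicator {0..c} t) \<partial>lborel)"
      using assms that by (subst nn_integral_cmult) (auto simp: nn_integral_powr_from_0)
    also have "\<dots> \<le> lorentz_norm (ennreal r) 1 f"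
      unfolding lorentz_norm_one[OF \<open>r > 0\<close>]
    proof (rule nn_integral_mono)
      fix t :: real
      have "ennreal s * ennreal (t powr (1 / r - 1)) \<le> ennreal (t powr (1 / r)) * decr_rearr f t * ennreal (1 / t)" if "t > 0"
      proof -
        have "ennreal s * ennreal (t powr (1 / r - 1)) = ennreal (t powr (1 / r)) * ennreal s * ennreal (1 / t)"
          using that assms by (simp flip: ennreal_mult' ennreal_mult'' add: powr_diff)
        also have "\<dots> \<le> ennreal (t powr (1 / r)) * decr_rearr f t * ennreal (1 / t)"
          using ge by (intro mult_left_mono mult_right_mono) auto
        finally show ?thesis .
      qed
      then show "ennreal s * (ennreal (t powr (1 / r - 1)) * indicator {0..c} t) \<le> 
           ennreal (t powr (1 / r)) * decr_rearr f t * ennreal (1 / t) * indicator {0<..} t"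
        by (auto simp: indicator_def)
    qed
    finally show ?thesis using w assms by (simp flip: ennreal_mult')
  qed
  \<comment> \<open>This value makes the lower bound \<open>s * (c powr (1 / r) * r)\<close> equal
    to \<open>w + 1\<close>.\<close>
  define c where "c = ((w + 1) / (s * r)) powr r"
  have "c > 0" using w assms by (auto simp: c_def intro!: divide_pos_pos)
  moreover have "c powr (1 / r) = (w + 1) / (s * r)"
    using w assms by (simp add: c_def powr_powr)
  ultimately have "s * ((w + 1) / (s * r) * r) \<le> w" using le[of c] by simp
  then show False using assms by simp
qed

text \<open>Absolute continuity of the norm, which depends on the finite second index: level sets of
  finite measure shrink to the empty set, so the rearrangements tend to 0 pointwise, dominated by
  that of \<open>f\<close>.\<close>

lemma lorentz_norm_one_tendsto_0:
  fixes f :: "real ^ 'n::finite \<Rightarrow> complex"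
  assumes f: "f \<in> borel_measurable lebesgue" and r: "r > 0" and fin: "lorentz_norm (ennreal r) 1 f < \<infinity>"
    and E: "\<And>N. E N \<in> sets lebesgue" "decseq E" "(\<Inter>N. E N) = {}"
  shows "(\<lambda>N. lorentz_norm (ennreal r) 1 (\<lambda>x. indicator (E N) x * f x)) \<longlonglongrightarrow> 0"
proof -
  let ?g = "\<lambda>N::nat. (\<lambda>x. indicator (E N) x * f x)"
  note [measurable] = f E(1)
  have eq: "{x. norm (?g N x) > s} = {x. norm (f x) > s} \<inter> E N" if "s > 0" for s N
    using that by (auto simp: indicator_def)
  have lim: "(\<lambda>N. emeasure lebesgue {x. norm (?g N x) > s}) \<longlonglongrightarrow> 0" if "s > 0" for s
  proof -
    note [measurable] = level_set_measurable[OF f]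
    have "(\<lambda>N. emeasure lebesgue ({x. norm (f x) > s} \<inter> E N)) \<longlonglongrightarrow> emeasure lebesgue (\<Inter>N. {x. norm (f x) > s} \<inter> E N)"
    proof (rule Lim_emeasure_decseq)
      show "decseq (\<lambda>N. {x. norm (f x) > s} \<inter> E N)" using E(2) unfolding decseq_def by blast
      have "emeasure lebesgue ({x. norm (f x) > s} \<inter> E N) \<le> emeasure lebesgue {x. norm (f x) > s}" for N
        by (rule emeasure_mono) auto
      then show "emeasure lebesgue ({x. norm (f x) > s} \<inter> E N) \<noteq> \<infinity>" for N
        using emeasure_finite_of_lorentz[OF f r fin that] by (metis leD infinity_ennreal_def)
    qed auto
    moreover have "(\<Inter>N. {x. norm (f x) > s} \<inter> E N) = {}" using E(3) by auto
    ultimately show ?thesis by (simp add: eq[OF that])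
  qed
  have lim2: "(\<lambda>N. decr_rearr (?g N) t) \<longlonglongrightarrow> 0" if "t > 0" for t
  proof (rule order_tendstoI)
    fix a :: ennreal assume "0 < a"
    then obtain a' where a': "0 < a'" "a' < a" using dense by blast
    then obtain s where s: "a' = ennreal s" "s > 0" by (cases a') auto
    have "\<forall>\<^sub>F N in sequentially. emeasure lebesgue {x. norm (?g N x) > s} < ennreal t"
      using lim[OF s(2)] that by (intro order_tendstoD) auto
    then show "\<forall>\<^sub>F N in sequentially. decr_rearr (?g N) t < a"
    proof eventually_elim
      case (elim N)
      then show ?case using decr_rearr_le[OF s(2), of "?g N" t] s a' less_imp_le[OF elim] by (auto intro: le_less_trans)
    qed
  qed auto
  have mono: "decr_rearr (?g N) t \<le> decr_rearr f t" for N t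
  proof (rule decr_rearr_mono)
    fix s :: real assume s: "s > 0"
    show "emeasure lebesgue {x. norm (?g N x) > s} \<le> emeasure lebesgue {x. norm (f x) > s}"
      unfolding eq[OF s] by (rule emeasure_mono) (use level_set_measurable[OF f] in auto)
  qed
  have "(\<lambda>N. \<integral>\<^sup>+ t\<in>{0<..}. ennreal (t powr (1 / r)) * decr_rearr (?g N) t * ennreal (1 / t) \<partial>lborel) \<longlonglongrightarrow>
     (\<integral>\<^sup>+ t. 0 \<partial>(lborel::real measure))"
  proof (rule nn_integral_dominated_convergence)
    show "(\<integral>\<^sup>+ t\<in>{0<..}. ennreal (t powr (1 / r)) * decr_rearr f t * ennreal (1 / t) \<partial>lborel) < \<infinity>"
      using fin r by (simp add: lorentz_norm_one)
    show "AE t in lborel. (\<lambda>N. ennreal (t powr (1 / r)) * decr_rearr (?g N) t * ennreal (1 / t) * indicator {0<..} t) \<longlonglongrightarrow> 0"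
    proof (rule AE_I2)
      fix t :: real
      show "(\<lambda>N. ennreal (t powr (1 / r)) * decr_rearr (?g N) t * ennreal (1 / t) * indicator {0<..} t) \<longlonglongrightarrow> 0"
      proof (cases "t > 0")
        case True
        have "(\<lambda>N. (ennreal (t powr (1 / r)) * ennreal (1 / t)) * decr_rearr (?g N) t) \<longlonglongrightarrow> (ennreal (t powr (1 / r)) * ennreal (1 / t)) * 0"
          by (intro ennreal_tendsto_cmult lim2 True) (auto simp: ennreal_mult_less_top)
        then show ?thesis using True by (simp add: mult_ac)
      qed auto
    qed
    show "AE x in lborel. ennreal (x powr (1 / r)) * decr_rearr (?g N) x * ennreal (1 / x) * indicator {0<..} x
         \<le> ennreal (x powr (1 / r)) * decr_rearr f x * ennreal (1 / x) * indicator {0<..} x" for N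
      using mono by (auto intro!: mult_left_mono mult_right_mono)
  qed auto
  then show ?thesis by (simp add: lorentz_norm_one[OF r])
qed

section \<open>Half-open cubes and step functions\<close>

text \<open>The cell containing \<open>x\<close> in the grid of mesh \<open>s\<close>. Comparing
  floors makes the cells equivalence classes, so they partition the space by construction.\<close>

definition cube :: "real \<Rightarrow> real ^ 'n::finite \<Rightarrow> (real ^ 'n) set" where
  "cube s x = {y. \<forall>i. \<lfloor>y $ i / s\<rfloor> = \<lfloor>x $ i / s\<rfloor>}"

lemma cube_self [simp]: "x \<in> cube s x"
  by (simp add: cube_def)

lemma cube_eq: "y \<in> cube s x \<Longrightarrow> cube s y = cube s x"
  by (simp add: cube_def)

text \<open>The floor of \<open>z / 2\<close> depends only on the floor of \<open>z\<close>; this is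
  the nesting of consecutive dyadic grids.\<close>

lemma cube_double_subset: "cube s x \<subseteq> cube (2 * s) x"
proof -
  have "\<lfloor>z / (2 * s)\<rfloor> = \<lfloor>z / s\<rfloor> div 2" for z :: real
    using floor_divide_real_eq_div[of 2 "z / s"] by (simp add: mult.commute)
  then show ?thesis by (auto simp: cube_def)
qed

lemma cube_power_subset: "i \<le> j \<Longrightarrow> cube (2 ^ i * s) x \<subseteq> cube (2 ^ j * s) x"
proof (induction j rule: dec_induct)
  case (step j)
  then show ?case using cube_double_subset[of "2 ^ j * s" x] by (auto simp: mult.assoc)
qed auto

lemma cube_component_diff:
  assumes "s > 0" "y \<in> cube s x"
  shows "\<bar>y $ i - x $ i\<bar> < s"
proof -
  have "\<lfloor>y $ i / s\<rfloor> = \<lfloor>x $ i / s\<rfloor>" using assms by (simp add: cube_def)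
  then have "\<bar>y $ i / s - x $ i / s\<bar> < 1" by linarith
  then show ?thesis using \<open>s > 0\<close> by (simp add: abs_if field_simps split: if_splits)
qed

lemma cube_norm_diff:
  assumes "s > 0" "y \<in> cube s (x :: real ^ 'n::finite)"
  shows "norm (y - x) \<le> real CARD('n) * s"
proof -
  have "norm (y - x) \<le> (\<Sum>i\<in>UNIV. \<bar>(y - x) $ i\<bar>)" by (rule norm_le_l1_cart)
  also have "\<dots> \<le> (\<Sum>i\<in>(UNIV :: 'n set). s)"
    using cube_component_diff[OF assms] by (intro sum_mono) (auto simp: less_imp_le)
  finally show ?thesis by simp
qed

lemma emeasure_lborel_cbox_cube:
  fixes a :: "real ^ 'n::finite"
  assumes "s \<ge> 0"
  shows "emeasure lborel (cbox a (a + s *\<^sub>R One)) = ennreal (s ^ CARD('n))"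
    and "emeasure lborel (box a (a + s *\<^sub>R One)) = ennreal (s ^ CARD('n))"
  using assms by (auto simp: emeasure_lborel_cbox_eq emeasure_lborel_box_eq inner_simps)

lemma One_component: "(One :: real ^ 'n::finite) $ i = 1"
  using inner_sum_left_Basis[of "axis i 1 :: real ^ 'n" "\<lambda>_. 1"] by (simp add: cart_eq_inner_axis)

text \<open>The measure of a half-open cube is squeezed between the equal measures of the open and
  the closed box; the closed one also yields boundedness.\<close>

lemma cube_sandwich:
  fixes x :: "real ^ 'n::finite"
  assumes "s > 0"
  defines "a \<equiv> (\<chi> i. s * of_int \<lfloor>x $ i / s\<rfloor>)"
  shows "box a (a + s *\<^sub>R One) \<subseteq> cube s x" "cube s x \<subseteq> cbox a (a + s *\<^sub>R One)"
proof -
  have *: "y \<in> cube s x \<longleftrightarrow> (\<forall>i. a $ i \<le> y $ i \<and> y $ i < a $ i + s)" for y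
    using \<open>s > 0\<close> by (simp add: cube_def a_def floor_eq_iff field_simps)
  show "box a (a + s *\<^sub>R One) \<subseteq> cube s x" "cube s x \<subseteq> cbox a (a + s *\<^sub>R One)"
    using * by (auto simp: mem_box_cart One_component less_imp_le simp del: sum_component)
qed

lemma cube_borel [measurable]: "cube s x \<in> sets borel"
  unfolding cube_def by measurable

lemma emeasure_cube:
  fixes x :: "real ^ 'n::finite"
  assumes "s > 0"
  shows "emeasure lborel (cube s x) = ennreal (s ^ CARD('n))"
proof (rule antisym)
  show "emeasure lborel (cube s x) \<le> ennreal (s ^ CARD('n))"
    using emeasure_mono[OF cube_sandwich(2)[OF assms, of x], of lborel] emeasure_lborel_cbox_cube(1) assms
    by (metis less_imp_le lborelD borel_closed closed_cbox sets_lborel)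
  show "ennreal (s ^ CARD('n)) \<le> emeasure lborel (cube s x)"
    using emeasure_mono[OF cube_sandwich(1)[OF assms, of x], of lborel] emeasure_lborel_cbox_cube(2) assms
    by (metis less_imp_le cube_borel sets_lborel)
qed

lemma measure_cube:
  fixes x :: "real ^ 'n::finite"
  assumes "s > 0"
  shows "measure lborel (cube s x) = s ^ CARD('n)"
  using emeasure_cube[OF assms, of x] assms by (simp add: measure_def)

lemma countable_cubes: "countable (range (cube s :: real ^ 'n::finite \<Rightarrow> _))"
proof -
  have "cube s x = (\<lambda>v::int ^ 'n. {y. \<forall>i. \<lfloor>y $ i / s\<rfloor> = v $ i}) (\<chi> i. \<lfloor>x $ i / s\<rfloor>)" for x :: "real ^ 'n"
    by (simp add: cube_def)
  then have "range (cube s) \<subseteq> range (\<lambda>v::int ^ 'n. {y. \<forall>i. \<lfloor>y $ i / s\<rfloor> = v $ i})" by blast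
  then show ?thesis by (rule countable_subset) simp
qed

text \<open>The working class, which despite its name also requires bounded values. Its measurable
  members are integrable and lie in the domain of the operator, and it is closed under finite
  sums.\<close>

definition bounded_support :: "('a::euclidean_space \<Rightarrow> complex) \<Rightarrow> bool" where
  "bounded_support f \<longleftrightarrow> bounded (range f) \<and> bounded {x. f x \<noteq> 0}"

definition step_function :: "real \<Rightarrow> (real ^ 'n::finite \<Rightarrow> complex) \<Rightarrow> bool" where
  "step_function h f \<longleftrightarrow> (\<forall>x. \<forall>y\<in>cube h x. f y = f x) \<and> bounded_support f"

section \<open>Closure properties of bounded support and of step functions\<close>

lemma bounded_support_add:
  assumes "bounded_support f" "bounded_support g"
  shows "bounded_support (\<lambda>x. f x + g x)"
proof -
  obtain A B where "\<And>x. norm (f x) \<le> A" "\<And>x. norm (g x) \<le> B"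
    using assms by (auto simp: bounded_support_def bounded_iff)
  then have "norm (f x + g x) \<le> A + B" for x by (meson add_mono norm_triangle_le)
  moreover have "bounded {x. f x + g x \<noteq> 0}"
    by (rule bounded_subset[of "{x. f x \<noteq> 0} \<union> {x. g x \<noteq> 0}"]) (use assms in \<open>auto simp: bounded_support_def\<close>)
  ultimately show ?thesis by (auto simp: bounded_support_def bounded_iff)
qed

lemma bounded_support_cmult:
  assumes "bounded_support f" "bounded (range g)"
  shows "bounded_support (\<lambda>x. g x * f x)"
proof -
  obtain A B where AB: "\<And>x. norm (f x) \<le> A" "\<And>x. norm (g x) \<le> B"
    using assms by (auto simp: bounded_support_def bounded_iff)
  then have "norm (g x * f x) \<le> B * A" for x
    by (metis norm_mult mult_mono' norm_ge_zero)
  moreover have "bounded {x. g x * f x \<noteq> 0}"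
    by (rule bounded_subset[of "{x. f x \<noteq> 0}"]) (use assms in \<open>auto simp: bounded_support_def\<close>)
  ultimately show ?thesis by (auto simp: bounded_support_def bounded_iff)
qed

lemma bounded_support_sum:
  "(\<And>i. i \<in> I \<Longrightarrow> bounded_support (f i)) \<Longrightarrow> bounded_support (\<lambda>x. \<Sum>i\<in>I. f i x)"
proof (induction I rule: infinite_finite_induct)
  case (insert i I)
  then show ?case using bounded_support_add[of "f i" "\<lambda>x. \<Sum>i\<in>I. f i x"] by simp
qed (auto simp: bounded_support_def)

lemma bounded_support_integrable:
  assumes f: "bounded_support f" "f \<in> borel_measurable lebesgue"
  shows "integrable lebesgue f"
proof -
  obtain A where A: "\<And>x. norm (f x) \<le> A" using f by (auto simp: bounded_support_def bounded_iff)
  obtain a where "{x. f x \<noteq> 0} \<subseteq> cbox (-a) a"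
    using f bounded_subset_cbox_symmetric by (metis bounded_support_def)
  then have a: "f x = 0" if "x \<notin> cbox (-a) a" for x using that by blast
  show ?thesis
  proof (rule Bochner_Integration.integrable_bound[where f = "\<lambda>x. A * indicator (cbox (-a) a) x"])
    show "integrable lebesgue (\<lambda>x. A * indicator (cbox (-a) a) x)"
      by (intro integrable_mult_right integrable_real_indicator) (auto simp: emeasure_lborel_cbox_eq)
    show "AE x in lebesgue. norm (f x) \<le> norm (A * indicator (cbox (- a) a) x)"
      using A a by (auto simp: indicator_def intro: order_trans[OF _ abs_ge_self])
  qed (use f in auto)
qed

lemma step_function_bounded_support: "step_function h f \<Longrightarrow> bounded_support f"
  by (simp add: step_function_def)

text \<open>Each preimage is a union of cells, and there are only countably many cells.\<close>

lemma step_function_borel: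
  assumes "step_function h f"
  shows "f \<in> borel_measurable borel"
proof (rule borel_measurableI)
  fix S :: "complex set"
  have "f -` S = \<Union>{Q\<in>range (cube h). Q \<subseteq> f -` S}"
  proof (intro equalityI subsetI)
    fix x assume "x \<in> f -` S"
    then have "cube h x \<subseteq> f -` S" using assms by (auto simp: step_function_def)
    then show "x \<in> \<Union>{Q\<in>range (cube h). Q \<subseteq> f -` S}" using cube_self by blast
  qed auto
  moreover have "\<Union>{Q\<in>range (cube h). Q \<subseteq> f -` S} \<in> sets borel"
    by (intro sets.countable_Union countable_subset[OF _ countable_cubes[of h]]) auto
  ultimately show "f -` S \<inter> space borel \<in> sets borel" by simp
qed

lemma step_function_add:
  "step_function h f \<Longrightarrow> step_function h g \<Longrightarrow> step_function h (\<lambda>x. f x + g x)"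
  by (auto simp: step_function_def intro: bounded_support_add)

lemma step_function_cmult:
  "step_function h f \<Longrightarrow> step_function h (\<lambda>x. c * f x)"
  using bounded_support_cmult[of f "\<lambda>_. c"] by (auto simp: step_function_def)

lemma step_function_refine:
  assumes "step_function (2 ^ k * h) f"
  shows "step_function h f"
  using assms cube_power_subset[of 0 k h] by (auto simp: step_function_def)

text \<open>The cubes are picked from above: around a point the largest dyadic cube is taken on
  which the mean of the norm of \<open>f\<close> exceeds \<open>\<alpha>\<close>. It exists because
  the finite total mass pushes the means over huge cubes below \<open>\<alpha>\<close>. Off all
  selected cubes even the smallest cell has mean at most \<open>\<alpha>\<close>, and there the mean
  is the value of the step function itself.\<close>

lemma dyadic_cz_cubes:
  fixes f :: "real ^ 'n::finite \<Rightarrow> complex"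
  assumes f: "step_function h f" and h: "h > 0" and \<alpha>: "\<alpha> > 0"
  obtains \<Q> where "finite \<Q>" "disjoint \<Q>" "\<And>Q. Q \<in> \<Q> \<Longrightarrow> \<exists>s>0. \<exists>x. Q = cube s x"
    "\<And>Q. Q \<in> \<Q> \<Longrightarrow> \<alpha> * measure lborel Q < (\<integral>x. indicator Q x * norm (f x) \<partial>lborel)"
    "\<And>Q. Q \<in> \<Q> \<Longrightarrow> (\<integral>x. indicator Q x * norm (f x) \<partial>lborel) \<le> 2 ^ CARD('n) * \<alpha> * measure lborel Q"
    "\<And>x. x \<notin> \<Union>\<Q> \<Longrightarrow> norm (f x) \<le> \<alpha>"
proof -
  define I where "I A = (\<integral>x. indicator A x * norm (f x) \<partial>lborel)" for A
  define L where "L = (\<integral>x. norm (f x) \<partial>lborel)"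
  define P where "P x j \<longleftrightarrow> I (cube (2 ^ j * h) x) > \<alpha> * (2 ^ j * h) ^ CARD('n)" for x j
  define \<Omega> where "\<Omega> = {x. \<exists>j. P x j}"
  define J where "J x = Greatest (P x)" for x
  define q where "q x = cube (2 ^ J x * h) x" for x
  note [measurable] = step_function_borel[OF f]
  have int: "integrable lborel f"
    using bounded_support_integrable[OF step_function_bounded_support[OF f]]
    by (simp add: integrable_completion measurable_completion)
  have int': "integrable lborel (\<lambda>x. indicator A x * norm (f x))" if [measurable]: "A \<in> sets borel" for A
    using integrable_mult_indicator[of A lborel "\<lambda>x. norm (f x)"] int by simp
  have I_mono: "I A \<le> I B" if "A \<subseteq> B" "A \<in> sets borel" "B \<in> sets borel" for A B
    unfolding I_def using that by (intro integral_mono int') (auto simp: indicator_def)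
  have I_le: "I A \<le> L" if "A \<in> sets borel" for A
    unfolding I_def L_def using that int by (intro integral_mono int') (auto simp: indicator_def)
  have L: "L \<ge> 0" by (simp add: L_def)
  \<comment> \<open>Bounds the admissible scales uniformly in \<open>x\<close>. The maximum with 1
    is there because a side length is dominated by its \<open>CARD('n)\<close>-th power only from 1
    on.\<close>
  define N where "N = nat \<lceil>max 1 (L / \<alpha>) / h\<rceil>"
  have bound: "j \<le> N" if "P x j" for x j
  proof -
    have "\<alpha> * (2 ^ j * h) ^ CARD('n) < L"
      using that I_le[of "cube (2 ^ j * h) x"] by (auto simp: P_def)
    then have *: "(2 ^ j * h) ^ CARD('n) < L / \<alpha>" using \<alpha> by (simp add: field_simps)
    have "2 ^ j * h \<le> max 1 (L / \<alpha>)"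
    proof (cases "2 ^ j * h \<ge> 1")
      case True
      then have "2 ^ j * h \<le> (2 ^ j * h) ^ CARD('n)" by (simp add: self_le_power)
      then show ?thesis using * by simp
    qed auto
    then have "2 ^ j \<le> max 1 (L / \<alpha>) / h" using h by (simp add: field_simps)
    moreover have "real j \<le> 2 ^ j" using less_exp[of j] by (metis less_imp_le of_nat_less_numeral_power_cancel_iff)
    ultimately have "real j \<le> max 1 (L / \<alpha>) / h" by linarith
    then show ?thesis unfolding N_def by linarith
  qed
  have PJ: "P x (J x)" if "x \<in> \<Omega>" for x
    using that GreatestI_ex_nat[of "P x" N] bound by (auto simp: \<Omega>_def J_def)
  have J_ge: "j \<le> J x" if "P x j" for x j
    unfolding J_def using that bound by (intro Greatest_le_nat)
  \<comment> \<open>At all scales from \<open>J x\<close> on, \<open>x\<close> and \<open>y\<close>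
    share their cube, so \<open>P\<close> agrees for both. Hence \<open>J y\<close> is at least
    \<open>J x\<close>, and maximality of \<open>J x\<close> gives equality. Selected cubes that
    meet therefore coincide.\<close>
  have q: "q y = q x \<and> y \<in> \<Omega>" if x: "x \<in> \<Omega>" and y: "y \<in> q x" for x y
  proof -
    have c: "cube (2 ^ j * h) y = cube (2 ^ j * h) x" if "j \<ge> J x" for j
      using y cube_power_subset[OF that, of h x] by (intro cube_eq) (auto simp: q_def)
    then have Pc: "P y j \<longleftrightarrow> P x j" if "j \<ge> J x" for j using that by (simp add: P_def)
    have "P y (J x)" using PJ[OF x] Pc by simp
    then have y': "y \<in> \<Omega>" and le: "J x \<le> J y" using J_ge by (auto simp: \<Omega>_def)
    have "J y \<le> J x" using PJ[OF y'] Pc[OF le] J_ge by simp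
    with le have "J y = J x" by simp
    then show ?thesis using c[of "J x"] y' by (simp add: q_def)
  qed
  define \<Q> where "\<Q> = q ` \<Omega>"
  have Un: "\<Union>\<Q> = \<Omega>"
  proof
    show "\<Union>\<Q> \<subseteq> \<Omega>" using q unfolding \<Q>_def by blast
    show "\<Omega> \<subseteq> \<Union>\<Q>" using cube_self unfolding \<Q>_def q_def by blast
  qed
  have dj: "disjoint \<Q>"
  proof (rule disjointI)
    fix A B assume "A \<in> \<Q>" "B \<in> \<Q>" "A \<noteq> B"
    then show "A \<inter> B = {}" using q unfolding \<Q>_def by (smt (verit) disjoint_iff image_iff)
  qed
  have mq: "measure lborel (q x) = (2 ^ J x * h) ^ CARD('n)" for x
    using h by (simp add: q_def measure_cube)
  have qb [measurable]: "q x \<in> sets borel" for x by (simp add: q_def)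
  have low: "\<alpha> * measure lborel Q < I Q" if "Q \<in> \<Q>" for Q
    using that PJ by (auto simp: \<Q>_def mq P_def) (simp add: q_def)
  have up: "I Q \<le> 2 ^ CARD('n) * \<alpha> * measure lborel Q" if Q: "Q \<in> \<Q>" for Q
  proof -
    obtain x where x: "x \<in> \<Omega>" "Q = q x" using Q by (auto simp: \<Q>_def)
    \<comment> \<open>The parent cube fails the test and has \<open>2 ^ CARD('n)\<close> times the
      measure.\<close>
    have "\<not> P x (Suc (J x))" using J_ge[of x "Suc (J x)"] by auto
    moreover have "I Q \<le> I (cube (2 ^ Suc (J x) * h) x)"
      using cube_power_subset[of "J x" "Suc (J x)" h x] by (intro I_mono) (auto simp: x q_def)
    ultimately have "I Q \<le> \<alpha> * (2 ^ Suc (J x) * h) ^ CARD('n)" by (simp add: P_def)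
    then show ?thesis by (simp add: x mq power_mult_distrib mult_ac)
  qed
  \<comment> \<open>Every selected cube has side at least \<open>h\<close>, so it carries mass at
    least \<open>\<alpha> * h ^ CARD('n)\<close>; disjoint cubes share the total mass
    \<open>L\<close>.\<close>
  have fin: "finite \<Q> \<and> card \<Q> \<le> nat \<lfloor>L / (\<alpha> * h ^ CARD('n))\<rfloor>"
  proof (rule finite_if_finite_subsets_card_bdd)
    fix G assume G: "G \<subseteq> \<Q>" "finite G"
    have Gb: "Q \<in> sets borel" if "Q \<in> G" for Q using that G by (auto simp: \<Q>_def)
    have "real (card G) * (\<alpha> * h ^ CARD('n)) = (\<Sum>Q\<in>G. \<alpha> * h ^ CARD('n))" by simp
    also have "\<dots> \<le> (\<Sum>Q\<in>G. I Q)"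
    proof (rule sum_mono)
      fix Q assume "Q \<in> G"
      then have "Q \<in> \<Q>" using G(1) by (rule subsetD[rotated])
      then obtain x where x: "x \<in> \<Omega>" "Q = q x" by (auto simp: \<Q>_def)
      have "h ^ CARD('n) \<le> measure lborel Q"
        unfolding x mq using h by (intro power_mono) (auto simp: mult_le_cancel_right1)
      then have "\<alpha> * h ^ CARD('n) \<le> \<alpha> * measure lborel Q" using \<alpha> by simp
      then show "\<alpha> * h ^ CARD('n) \<le> I Q" using low[of Q] \<open>Q \<in> G\<close> G by auto
    qed
    also have "\<dots> = (\<integral>x. (\<Sum>Q\<in>G. indicator Q x * norm (f x)) \<partial>lborel)"
      unfolding I_def using Gb by (subst Bochner_Integration.integral_sum) (auto intro: int')
    also have "\<dots> \<le> L"
      unfolding L_def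
    proof (rule integral_mono)
      show "integrable lborel (\<lambda>x. \<Sum>Q\<in>G. indicator Q x * norm (f x))"
        using Gb by (intro Bochner_Integration.integrable_sum int') auto
      fix x
      have "(\<Sum>Q\<in>G. indicator Q x * norm (f x)) = indicator (\<Union>G) x * norm (f x)"
        using G dj by (subst indicator_UN_disjoint[of G "\<lambda>x. x", simplified])
           (auto simp: sum_distrib_right disjoint_family_on_def disjoint_def)
      then show "(\<Sum>Q\<in>G. indicator Q x * norm (f x)) \<le> norm (f x)" by (simp add: indicator_def)
    qed (use int in auto)
    finally have "real (card G) \<le> L / (\<alpha> * h ^ CARD('n))" using \<alpha> h by (simp add: field_simps)
    then show "card G \<le> nat \<lfloor>L / (\<alpha> * h ^ CARD('n))\<rfloor>" by linarith
  qed
  have out: "norm (f x) \<le> \<alpha>" if "x \<notin> \<Union>\<Q>" for x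
  proof -
    have "\<not> P x 0" using that Un by (auto simp: \<Omega>_def)
    then have "I (cube h x) \<le> \<alpha> * h ^ CARD('n)" by (simp add: P_def)
    moreover have "I (cube h x) = (\<integral>y. indicator (cube h x) y * norm (f x) \<partial>lborel)"
      unfolding I_def using f by (intro Bochner_Integration.integral_cong) (auto simp: indicator_def step_function_def)
    ultimately show ?thesis using h \<alpha> measure_cube[OF h, of x] by (cases "f x = 0") auto
  qed
  show thesis
  proof (rule that[of \<Q>])
    show "\<exists>s>0. \<exists>x. Q = cube s x" if Q: "Q \<in> \<Q>" for Q
    proof -
      obtain x where "Q = cube (2 ^ J x * h) x" using Q by (auto simp: \<Q>_def q_def)
      then show ?thesis using h by (intro exI[of _ "2 ^ J x * h"]) auto
    qed
  qed (use fin dj low up out in \<open>auto simp: I_def\<close>)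
qed

section \<open>Calderon-Zygmund decomposition of step functions\<close>

text \<open>The good part is the mean of \<open>f\<close> on each stopping cube and \<open>f\<close>
  elsewhere. Averaging contracts the integral of the norm, so \<open>g\<close> has no more mass than
  \<open>f\<close>, while each \<open>b Q\<close> costs at most twice the mass of \<open>f\<close>
  on \<open>Q\<close>.\<close>

lemma cz_decomposition:
  fixes f :: "real ^ 'n::finite \<Rightarrow> complex"
  assumes f: "step_function h f" and h: "h > 0" and \<alpha>: "\<alpha> > 0"
  obtains \<Q> g b where "finite \<Q>" "\<And>Q. Q \<in> \<Q> \<Longrightarrow> \<exists>s>0. \<exists>x. Q = cube s x"
    "\<alpha> * (\<Sum>Q\<in>\<Q>. measure lborel Q) \<le> (\<integral>x. norm (f x) \<partial>lborel)"
    "\<And>x. f x = g x + (\<Sum>Q\<in>\<Q>. b Q x)"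
    "g \<in> borel_measurable borel" "bounded_support g" "\<And>x. norm (g x) \<le> 2 ^ CARD('n) * \<alpha>"
    "(\<integral>x. norm (g x) \<partial>lborel) \<le> (\<integral>x. norm (f x) \<partial>lborel)"
    "\<And>Q. Q \<in> \<Q> \<Longrightarrow> b Q \<in> borel_measurable borel"
    "\<And>Q. Q \<in> \<Q> \<Longrightarrow> bounded_support (b Q)"
    "\<And>Q x. Q \<in> \<Q> \<Longrightarrow> b Q x \<noteq> 0 \<Longrightarrow> x \<in> Q"
    "\<And>Q. Q \<in> \<Q> \<Longrightarrow> (\<integral>x. b Q x \<partial>lborel) = 0"
    "(\<Sum>Q\<in>\<Q>. \<integral>x. norm (b Q x) \<partial>lborel) \<le> 2 * (\<integral>x. norm (f x) \<partial>lborel)"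
proof -
  obtain \<Q> where fin: "finite \<Q>" and dj: "disjoint \<Q>" and cu: "\<And>Q. Q \<in> \<Q> \<Longrightarrow> \<exists>s>0. \<exists>x. Q = cube s x"
    and lo: "\<And>Q. Q \<in> \<Q> \<Longrightarrow> \<alpha> * measure lborel Q < (\<integral>x. indicator Q x * norm (f x) \<partial>lborel)"
    and up: "\<And>Q. Q \<in> \<Q> \<Longrightarrow> (\<integral>x. indicator Q x * norm (f x) \<partial>lborel) \<le> 2 ^ CARD('n) * \<alpha> * measure lborel Q"
    and out: "\<And>x. x \<notin> \<Union>\<Q> \<Longrightarrow> norm (f x) \<le> \<alpha>"
    by (rule dyadic_cz_cubes[OF f h \<alpha>]; rule that; assumption)
  define I where "I A = (\<integral>x. indicator A x * norm (f x) \<partial>lborel)" for A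
  define m where "m Q = measure lborel Q" for Q :: "(real ^ 'n) set"
  define avg where "avg Q = (\<integral>x. indicator Q x * f x \<partial>lborel) / of_real (m Q)" for Q
  define b where "b Q x = indicator Q x * (f x - avg Q)" for Q x
  define g where "g x = f x - (\<Sum>Q\<in>\<Q>. b Q x)" for x
  define R where "R = - \<Union>\<Q>"
  have fm [measurable]: "f \<in> borel_measurable borel" by (rule step_function_borel[OF f])
  have Qm [measurable]: "Q \<in> sets borel" if "Q \<in> \<Q>" for Q using cu[OF that] by auto
  have Rm [measurable]: "R \<in> sets borel" unfolding R_def using fin Qm by (intro borel_comp sets.finite_Union) auto
  have Qe: "emeasure lborel Q < \<infinity>" if "Q \<in> \<Q>" for Q using cu[OF that] by (auto simp: emeasure_cube)
  have mpos: "m Q > 0" if "Q \<in> \<Q>" for Q using cu[OF that] by (auto simp: measure_cube m_def)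
  have int: "integrable lborel f"
    using bounded_support_integrable[OF step_function_bounded_support[OF f]]
    by (simp add: integrable_completion measurable_completion)
  have int': "integrable lborel (\<lambda>x. indicator A x * norm (f x))" if [measurable]: "A \<in> sets borel" for A
    using integrable_mult_indicator[of A lborel "\<lambda>x. norm (f x)"] int by simp
  have ind_scale: "indicator A x *\<^sub>R z = indicator A x * z" for A and x :: "real ^ 'n" and z :: complex
    by (simp add: indicator_def)
  have intc: "integrable lborel (\<lambda>x. indicator A x * f x)" if [measurable]: "A \<in> sets borel" for A
    using integrable_mult_indicator[of A lborel f] int by (simp add: ind_scale)
  have inti: "integrable lborel (\<lambda>x. indicator Q x * c)" "(\<integral>x. indicator Q x * c \<partial>lborel) = of_real (m Q) * c" 
     if "Q \<in> \<Q>" for Q and c :: complex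
  proof -
    have "has_bochner_integral lborel (\<lambda>x. indicator Q x *\<^sub>R c) (measure lborel Q *\<^sub>R c)"
      using Qe[OF that] Qm[OF that] by (intro has_bochner_integral_indicator) auto
    then show "integrable lborel (\<lambda>x. indicator Q x * c)" "(\<integral>x. indicator Q x * c \<partial>lborel) = of_real (m Q) * c"
      unfolding ind_scale unfolding has_bochner_integral_iff m_def scaleR_conv_of_real by blast+
  qed
  have intr: "integrable lborel (\<lambda>x. indicator Q x * c)" "(\<integral>x. indicator Q x * c \<partial>lborel) = m Q * c" 
     if "Q \<in> \<Q>" for Q and c :: real
    using Qe[OF that] Qm[OF that] by (auto simp: m_def)
  \<comment> \<open>Disjointness leaves a single nonzero summand at each point of a cube.\<close>
  have sel: "(\<Sum>Q'\<in>\<Q>. indicator Q' x * c Q') = c Q" if "Q \<in> \<Q>" "x \<in> Q" for Q x and c :: "(real ^ 'n) set \<Rightarrow> 'z::real_normed_field"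
  proof -
    have "(\<Sum>Q'\<in>\<Q>. indicator Q' x * c Q') = (\<Sum>Q'\<in>{Q}. indicator Q' x * c Q')"
      using fin that dj by (intro sum.mono_neutral_right) (auto simp: disjoint_def indicator_def)
    then show ?thesis using that by simp
  qed
  have sel0: "(\<Sum>Q'\<in>\<Q>. indicator Q' x * c Q') = 0" if "x \<in> R" for x and c :: "(real ^ 'n) set \<Rightarrow> 'z::real_normed_field"
    using that by (intro sum.neutral) (auto simp: R_def)
  have gin: "g x = avg Q" if "Q \<in> \<Q>" "x \<in> Q" for x Q
    using sel[OF that, of "\<lambda>Q. f x - avg Q"] by (simp add: g_def b_def)
  have gout: "g x = f x" if "x \<in> R" for x
    using sel0[OF that, of "\<lambda>Q. f x - avg Q"] by (simp add: g_def b_def)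
  have avg: "m Q * norm (avg Q) \<le> I Q" if "Q \<in> \<Q>" for Q
  proof -
    have "norm (\<integral>x. indicator Q x * f x \<partial>lborel) \<le> (\<integral>x. norm (indicator Q x * f x) \<partial>lborel)"
      by (rule integral_norm_bound)
    also have "\<dots> = I Q" unfolding I_def
      by (intro Bochner_Integration.integral_cong) (auto simp: norm_mult indicator_def)
    finally show ?thesis using mpos[OF that] by (simp add: avg_def norm_divide)
  qed
  have norm_g: "norm (g x) = indicator R x * norm (f x) + (\<Sum>Q\<in>\<Q>. indicator Q x * norm (avg Q))" for x
  proof (cases "x \<in> R")
    case True
    then show ?thesis using sel0[OF True, of "\<lambda>Q. norm (avg Q)"] by (simp add: gout)
  next
    case False
    then obtain Q where "Q \<in> \<Q>" "x \<in> Q" by (auto simp: R_def)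
    then show ?thesis using sel[of Q x "\<lambda>Q. norm (avg Q)"] False by (simp add: gin)
  qed
  have norm_f: "norm (f x) = indicator R x * norm (f x) + (\<Sum>Q\<in>\<Q>. indicator Q x * norm (f x))" for x
  proof (cases "x \<in> R")
    case True
    then show ?thesis using sel0[OF True, of "\<lambda>Q. norm (f x)"] by simp
  next
    case False
    then obtain Q where "Q \<in> \<Q>" "x \<in> Q" by (auto simp: R_def)
    then show ?thesis using sel[of Q x "\<lambda>Q. norm (f x)"] False by simp
  qed
  have int_f: "(\<integral>x. norm (f x) \<partial>lborel) = I R + (\<Sum>Q\<in>\<Q>. I Q)"
    unfolding I_def using Qm
    by (subst norm_f, subst Bochner_Integration.integral_add) (auto intro!: int' Bochner_Integration.integrable_sum Bochner_Integration.integral_sum)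
  have int_g: "(\<integral>x. norm (g x) \<partial>lborel) = I R + (\<Sum>Q\<in>\<Q>. m Q * norm (avg Q))"
  proof -
    have "(\<integral>x. (\<Sum>Q\<in>\<Q>. indicator Q x * norm (avg Q)) \<partial>lborel) = (\<Sum>Q\<in>\<Q>. \<integral>x. indicator Q x * norm (avg Q) \<partial>lborel)"
      by (intro Bochner_Integration.integral_sum intr)
    also have "\<dots> = (\<Sum>Q\<in>\<Q>. m Q * norm (avg Q))" by (intro sum.cong refl intr)
    finally show ?thesis
      unfolding I_def by (subst norm_g, subst Bochner_Integration.integral_add)
        (auto intro!: int' intr Bochner_Integration.integrable_sum)
  qed
  have I_R: "I R \<ge> 0" unfolding I_def by (intro Bochner_Integration.integral_nonneg) auto
  have b_eq: "b Q = (\<lambda>x. indicator Q x * f x - indicator Q x * avg Q)" for Q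
    by (auto simp: b_def algebra_simps)
  have bint: "integrable lborel (b Q)" if "Q \<in> \<Q>" for Q
    unfolding b_eq using that by (intro Bochner_Integration.integrable_diff intc inti Qm)
  have bbs: "bounded_support (b Q)" if Q: "Q \<in> \<Q>" for Q
  proof -
    obtain s x where s: "s > 0" "Q = cube s x" using cu[OF Q] by auto
    have "bounded Q" unfolding s(2)
      by (rule bounded_subset[OF bounded_cbox cube_sandwich(2)[OF s(1)]])
    moreover have "bounded (range (\<lambda>x. f x - avg Q))"
      using bounded_minus_comp[of "f" UNIV "\<lambda>_. avg Q"] f by (simp add: step_function_def bounded_support_def)
    moreover have "bounded (range (indicator Q :: _ \<Rightarrow> complex))"
      by (rule boundedI[of _ 1]) (auto simp: indicator_def)
    ultimately have "bounded_support (indicator Q :: _ \<Rightarrow> complex)"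
      by (simp add: bounded_support_def indicator_eq_0_iff)
    then have "bounded_support (\<lambda>x. (f x - avg Q) * indicator Q x)"
      by (rule bounded_support_cmult) fact
    then show ?thesis by (simp add: b_def[abs_def] mult.commute)
  qed
  show thesis
  proof (rule that[of \<Q> g b])
    show "\<alpha> * (\<Sum>Q\<in>\<Q>. measure lborel Q) \<le> (\<integral>x. norm (f x) \<partial>lborel)"
    proof -
      have "\<alpha> * (\<Sum>Q\<in>\<Q>. measure lborel Q) = (\<Sum>Q\<in>\<Q>. \<alpha> * measure lborel Q)" by (rule sum_distrib_left)
      also have "\<dots> \<le> (\<Sum>Q\<in>\<Q>. I Q)" using lo by (intro sum_mono) (auto simp: I_def less_imp_le)
      finally show ?thesis using int_f I_R by simp
    qed
    show "f x = g x + (\<Sum>Q\<in>\<Q>. b Q x)" for x by (simp add: g_def)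
    show bm: "b Q \<in> borel_measurable borel" if "Q \<in> \<Q>" for Q
      unfolding b_eq using Qm[OF that] by measurable
    show "g \<in> borel_measurable borel" unfolding g_def[abs_def]
      by (intro borel_measurable_diff borel_measurable_sum fm bm)
    show "bounded_support g"
    proof -
      have "bounded_support (\<lambda>x. f x + (-1) * (\<Sum>Q\<in>\<Q>. b Q x))"
        by (intro bounded_support_add bounded_support_cmult bounded_support_sum bbs step_function_bounded_support[OF f]) auto
      then show ?thesis by (simp add: g_def[abs_def])
    qed
    show "norm (g x) \<le> 2 ^ CARD('n) * \<alpha>" for x
    proof (cases "x \<in> R")
      case True
      then have "norm (g x) \<le> \<alpha>" using out by (simp add: gout R_def)
      also have "\<dots> \<le> 2 ^ CARD('n) * \<alpha>" using \<alpha> by (simp add: mult_le_cancel_right1)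
      finally show ?thesis .
    next
      case False
      then obtain Q where Q: "Q \<in> \<Q>" "x \<in> Q" by (auto simp: R_def)
      have "m Q * norm (avg Q) \<le> m Q * (2 ^ CARD('n) * \<alpha>)"
        using avg[OF Q(1)] up[OF Q(1)] by (simp add: I_def m_def mult_ac)
      then show ?thesis using mpos[OF Q(1)] by (simp add: gin[OF Q])
    qed
    show "(\<integral>x. norm (g x) \<partial>lborel) \<le> (\<integral>x. norm (f x) \<partial>lborel)"
      unfolding int_f int_g using avg by (intro add_left_mono sum_mono)
    show "x \<in> Q" if "Q \<in> \<Q>" "b Q x \<noteq> 0" for Q x using that by (auto simp: b_def indicator_def split: if_splits)
    show "(\<integral>x. b Q x \<partial>lborel) = 0" if "Q \<in> \<Q>" for Q
      unfolding b_eq Bochner_Integration.integral_diff[OF intc[OF Qm[OF that]] inti(1)[OF that]] inti(2)[OF that]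
      using mpos[OF that] by (simp add: avg_def)
    show "(\<Sum>Q\<in>\<Q>. \<integral>x. norm (b Q x) \<partial>lborel) \<le> 2 * (\<integral>x. norm (f x) \<partial>lborel)"
    proof -
      have "(\<integral>x. norm (b Q x) \<partial>lborel) \<le> 2 * I Q" if "Q \<in> \<Q>" for Q
      proof -
        have "(\<integral>x. norm (b Q x) \<partial>lborel) \<le> (\<integral>x. indicator Q x * norm (f x) + indicator Q x * norm (avg Q) \<partial>lborel)"
          by (intro integral_mono integrable_norm bint that Bochner_Integration.integrable_add int' intr Qm)
             (auto simp: b_def indicator_def intro: norm_triangle_ineq4)
        also have "\<dots> = I Q + m Q * norm (avg Q)"
          unfolding Bochner_Integration.integral_add[OF int'[OF Qm[OF that]] intr(1)[OF that]] intr(2)[OF that] I_def ..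
        finally show ?thesis using avg[OF that] by simp
      qed
      then have "(\<Sum>Q\<in>\<Q>. \<integral>x. norm (b Q x) \<partial>lborel) \<le> (\<Sum>Q\<in>\<Q>. 2 * I Q)" by (rule sum_mono)
      also have "\<dots> \<le> 2 * (\<integral>x. norm (f x) \<partial>lborel)" using int_f I_R by (simp flip: sum_distrib_left)
      finally show ?thesis .
    qed
  qed (use fin cu bbs in auto)
qed

section \<open>Kernel estimate for the bad part\<close>

text \<open>Completeness of Lebesgue measure. It supplies the measurability of integrands built from
  slices of \<open>K\<close>, which are only known to agree almost everywhere with Borel
  ones.\<close>

lemma measurable_lebesgue_AE_eq:
  fixes f g :: "'a::euclidean_space \<Rightarrow> complex"
  assumes f: "f \<in> borel_measurable lebesgue" and ae: "AE x in lebesgue. g x = f x"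
  shows "g \<in> borel_measurable lebesgue"
proof (rule measurableI)
  fix A :: "complex set" assume A: "A \<in> sets borel"
  have "f -` A \<inter> space lebesgue \<in> sets lebesgue" using f A by (rule measurable_sets)
  then have "f -` A \<in> sets lebesgue" by simp
  moreover have "AE x in lebesgue. x \<in> f -` A \<longleftrightarrow> x \<in> g -` A" using ae by eventually_elim auto
  ultimately have "g -` A \<in> sets lebesgue" by (intro completion.in_sets_AE[of "f -` A" "g -` A" lborel]) auto
  then show "g -` A \<inter> space lebesgue \<in> sets lebesgue" by simp
qed auto

lemma lebesgue_ex_borel_complex:
  fixes g :: "'a::euclidean_space \<Rightarrow> complex"
  assumes g: "g \<in> borel_measurable lebesgue"
  shows "\<exists>g'\<in>borel_measurable borel. AE x in lborel. g x = g' x"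
proof -
  obtain u where u [measurable]: "u \<in> borel_measurable lborel" "AE x in lborel. Re (g x) = u x"
    using completion_ex_borel_measurable_real[of "\<lambda>x. Re (g x)" lborel] g by auto
  obtain v where v [measurable]: "v \<in> borel_measurable lborel" "AE x in lborel. Im (g x) = v x"
    using completion_ex_borel_measurable_real[of "\<lambda>x. Im (g x)" lborel] g by auto
  show ?thesis
  proof (intro bexI)
    show "AE x in lborel. g x = Complex (u x) (v x)"
      using u(2) v(2) by eventually_elim (auto simp: complex_eq_iff)
    have "(\<lambda>x. of_real (u x) + \<i> * of_real (v x)) \<in> borel_measurable borel"
      using u(1) v(1) by measurable
    then show "(\<lambda>x. Complex (u x) (v x)) \<in> borel_measurable borel" by (simp add: Complex_eq)
  qed
qed

text \<open>A Borel version of the kernel makes Tonelli's theorem available; \<open>K\<close> itself is only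
  measurable for the completed product measure.\<close>

lemma kernel_borel_version:
  fixes K :: "real ^ 'n::finite \<Rightarrow> real ^ 'n \<Rightarrow> complex"
  assumes "(\<lambda>(x, y). K x y) \<in> borel_measurable (lebesgue_on {(x, y). x \<noteq> y})"
  obtains k where "k \<in> borel_measurable borel"
    "AE x in lborel. AE y in lborel. x \<noteq> y \<longrightarrow> K x y = k (x, y)"
    "AE y in lborel. AE x in lborel. x \<noteq> y \<longrightarrow> K x y = k (x, y)"
proof -
  let ?S = "{(x, y). x \<noteq> y} :: ((real ^ 'n) \<times> (real ^ 'n)) set"
  have "?S = - {p. fst p = snd p}" by auto
  moreover have "closed {p :: (real ^ 'n) \<times> (real ^ 'n). fst p = snd p}"
    by (intro closed_Collect_eq continuous_intros)
  ultimately have "open ?S" by (simp add: open_Compl)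
  then have "?S \<in> sets lebesgue" by (metis borel_open sets_completionI_sets sets_lborel)
  from borel_measurable_if_I[OF assms this] 
  obtain k where k: "k \<in> borel_measurable borel" 
    and ae: "AE p in lborel. (if p \<in> ?S then (case p of (x, y) \<Rightarrow> K x y) else 0) = k p"
    using lebesgue_ex_borel_complex by blast
  \<comment> \<open>The exceptional set is enlarged to a measurable null set \<open>N\<close>, since
    exchanging the two almost-everywhere quantifiers requires a set in the product
    sigma-algebra.\<close>
  obtain N where N: "{p\<in>space lborel. (if p \<in> ?S then (case p of (x, y) \<Rightarrow> K x y) else 0) \<noteq> k p} \<subseteq> N" 
    "N \<in> null_sets lborel"
    using ae by (auto simp: eventually_ae_filter)
  have "AE p in lborel \<Otimes>\<^sub>M lborel. p \<notin> N" using AE_not_in[OF N(2)] unfolding lborel_prod .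
  then have 1: "AE x in lborel. AE y in lborel. (x, y) \<notin> N" by (rule lborel_pair.AE_pair)
  have Nm: "N \<in> sets (lborel \<Otimes>\<^sub>M lborel)" using N(2) unfolding lborel_prod by (rule null_setsD2)
  have 2: "AE y in lborel. AE x in lborel. (x, y) \<notin> N"
  proof (subst lborel_pair.AE_commute[symmetric])
    have "space (lborel \<Otimes>\<^sub>M lborel) - N \<in> sets (lborel \<Otimes>\<^sub>M lborel)" using Nm by (rule sets.compl_sets)
    moreover have "space (lborel \<Otimes>\<^sub>M lborel) - N = {p \<in> space (lborel \<Otimes>\<^sub>M lborel). (fst p, snd p) \<notin> N}" by auto
    ultimately show "{p \<in> space (lborel \<Otimes>\<^sub>M lborel). (fst p, snd p) \<notin> N} \<in> sets (lborel \<Otimes>\<^sub>M lborel)" by simp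
  qed (rule 1)
  have NK: "K x y = k (x, y)" if "(x, y) \<notin> N" "x \<noteq> y" for x y using N(1) that by force
  show thesis
  proof (rule that[OF k])
    show "AE x in lborel. AE y in lborel. x \<noteq> y \<longrightarrow> K x y = k (x, y)"
      by (rule eventually_mono[OF 1], erule eventually_mono) (blast intro: NK)
    show "AE y in lborel. AE x in lborel. x \<noteq> y \<longrightarrow> K x y = k (x, y)"
      by (rule eventually_mono[OF 2], erule eventually_mono) (blast intro: NK)
  qed
qed

text \<open>A constant multiple of \<open>b\<close> may be subtracted because its integral vanishes.
  If the product with the shifted factor is not integrable, the right-hand side is infinite and the
  bound is trivial.\<close>

lemma norm_integral_cancel:
  fixes u b :: "'a \<Rightarrow> complex"
  assumes u: "u \<in> borel_measurable M" and b: "integrable M b" "(\<integral>y. b y \<partial>M) = 0"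
  shows "ennreal (norm (\<integral>y. u y * b y \<partial>M)) \<le> (\<integral>\<^sup>+y. ennreal (norm (u y - c) * norm (b y)) \<partial>M)"
proof (cases "integrable M (\<lambda>y. (u y - c) * b y)")
  case True
  have "(\<integral>y. u y * b y \<partial>M) = (\<integral>y. (u y - c) * b y + c * b y \<partial>M)"
    by (simp add: algebra_simps)
  also have "\<dots> = (\<integral>y. (u y - c) * b y \<partial>M)"
    using True b by (subst Bochner_Integration.integral_add) auto
  finally show ?thesis
    using integral_norm_bound_ennreal[OF True] by (simp add: norm_mult)
next
  case False
  then have "\<not> (\<integral>\<^sup>+y. ennreal (norm (u y - c) * norm (b y)) \<partial>M) < \<infinity>"
    using u b(1) by (auto simp: integrable_iff_bounded norm_mult)
  then have "(\<integral>\<^sup>+y. ennreal (norm (u y - c) * norm (b y)) \<partial>M) = \<infinity>"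
    by (metis infinity_ennreal_def top.not_eq_extremum)
  then show ?thesis by simp
qed

text \<open>As \<open>b\<close> has mean zero, the value at a base point \<open>y0\<close> may be
  subtracted from the kernel. Tonelli's theorem then leaves, for each \<open>y\<close>, the
  Hoermander integral of the pair \<open>y0\<close>, \<open>y\<close>, weighted by
  \<open>norm (b y)\<close>.\<close>

lemma kernel_cancellation:
  fixes K :: "real ^ 'n::finite \<Rightarrow> real ^ 'n \<Rightarrow> complex"
  assumes K: "associated_kernel V T K" "hoermander_condition K A'"
    and b: "b \<in> V" "b \<in> borel_measurable borel" "integrable lborel b" "(\<integral>y. b y \<partial>lborel) = 0"
    and s: "s > 0" "\<And>y. b y \<noteq> 0 \<Longrightarrow> y \<in> cube s z"
  obtains E where "E \<in> sets borel" "emeasure lborel E \<le> ennreal ((4 * real CARD('n) * s) ^ CARD('n))"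
    "(\<integral>\<^sup>+x. indicator (- E) x * ennreal (norm (T b x)) \<partial>lebesgue) \<le> ennreal A' * (\<integral>\<^sup>+y. ennreal (norm (b y)) \<partial>lborel)"
proof -
  let ?n = "real CARD('n)"
  obtain k where k [measurable]: "k \<in> borel_measurable borel"
    and kx: "AE x in lborel. AE y in lborel. x \<noteq> y \<longrightarrow> K x y = k (x, y)"
    and ky: "AE y in lborel. AE x in lborel. x \<noteq> y \<longrightarrow> K x y = k (x, y)"
    using kernel_borel_version K(1) unfolding associated_kernel_def by blast
  \<comment> \<open>The point \<open>y0\<close> of the cube is chosen such that the slice \<open>K(\<cdot>, y0)\<close> agrees with that of \<open>k\<close>
    almost everywhere.\<close>
  have "\<exists>y0\<in>cube s z. AE x in lborel. x \<noteq> y0 \<longrightarrow> K x y0 = k (x, y0)"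
  proof (rule ccontr)
    assume "\<not> ?thesis"
    with ky have "AE y in lborel. y \<notin> cube s z" by (auto elim: AE_mp)
    then have "emeasure lborel (cube s z) = 0" by (subst (asm) AE_iff_measurable[OF _ refl]) auto
    then show False using emeasure_cube[OF s(1), of z] zero_less_power[OF s(1), of "CARD('n)"] by (simp add: ennreal_eq_0_iff)
  qed
  then obtain y0 where y0: "y0 \<in> cube s z" and ky0: "AE x in lborel. x \<noteq> y0 \<longrightarrow> K x y0 = k (x, y0)" by blast
  have cu: "norm (y - y0) \<le> ?n * s" if "y \<in> cube s z" for y
    using cube_norm_diff[OF s(1), of y y0] that y0 by (simp add: cube_eq)
  \<comment> \<open>Points of the cube are within \<open>?n * s\<close> of \<open>y0\<close>, so a
    point outside the ball of radius \<open>d\<close> is at least twice as far from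
    \<open>y0\<close> as they are. The ball lies in a cube of side \<open>2 * d\<close>, whence the
    factor 4.\<close>
  define d where "d = 2 * ?n * s"
  have d: "d > 0" using s by (simp add: d_def)
  define E where "E = cball y0 d"
  have Em [measurable]: "E \<in> sets borel" by (simp add: E_def)
  have E: "norm (x - y0) > d" if "x \<notin> E" for x using that by (simp add: E_def dist_norm norm_minus_commute)
  have EE: "x \<noteq> y \<and> norm (x - y0) \<ge> 2 * norm (y0 - y)" if "x \<notin> E" "y \<in> cube s z" for x y
  proof -
    have "norm (y0 - y) \<le> ?n * s" using cu[OF that(2)] by (simp add: norm_minus_commute)
    moreover have "d = 2 * (?n * s)" "?n * s > 0" using s(1) by (simp_all add: d_def)
    moreover have "norm (x - y0) > d" by (rule E[OF that(1)])
    ultimately show ?thesis by (smt (verit) norm_minus_commute)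
  qed
  have Eem: "emeasure lborel E \<le> ennreal ((4 * ?n * s) ^ CARD('n))"
  proof -
    let ?a = "y0 - d *\<^sub>R One"
    have "E \<subseteq> cbox ?a (?a + (2 * d) *\<^sub>R One)"
    proof
      fix x assume "x \<in> E"
      then have n: "norm (x - y0) \<le> d" by (simp add: E_def dist_norm norm_minus_commute)
      have "\<bar>x $ i - y0 $ i\<bar> \<le> d" for i using component_le_norm_cart[of "x - y0" i] n by simp
      then show "x \<in> cbox ?a (?a + (2 * d) *\<^sub>R One)" 
        by (simp add: mem_box_cart One_component abs_le_iff algebra_simps del: sum_component)
    qed
    then have "emeasure lborel E \<le> emeasure lborel (cbox ?a (?a + (2 * d) *\<^sub>R One))"
      by (rule emeasure_mono) simp
    also have "\<dots> = ennreal ((4 * ?n * s) ^ CARD('n))"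
      using d by (subst emeasure_lborel_cbox_cube) (auto simp: d_def mult_ac)
    finally show ?thesis .
  qed
  have cl: "closure {y. b y \<noteq> 0} \<subseteq> cball y0 (?n * s)"
    by (rule closure_minimal) (use s(2) cu in \<open>auto simp: dist_norm norm_minus_commute\<close>)
  have "compact (closure {y. b y \<noteq> 0})"
    using bounded_subset[OF bounded_cball cl] closed_closure compact_eq_bounded_closed by blast
  then have "AE x in lebesgue. x \<notin> closure {y. b y \<noteq> 0} \<longrightarrow> T b x = (\<integral>y. K x y * b y \<partial>lebesgue)"
    using K(1) b(1) unfolding associated_kernel_def by blast
  \<comment> \<open>The closed support lies in the ball of radius \<open>?n * s\<close>, which is
    inside \<open>E\<close>, so the kernel formula is available off \<open>E\<close>.\<close>
  moreover have "x \<notin> closure {y. b y \<noteq> 0}" if "x \<notin> E" for x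
  proof -
    have "?n * s \<le> d" using s by (simp add: d_def)
    then show ?thesis using cl E[OF that] by (auto simp: dist_norm norm_minus_commute dest!: subsetD)
  qed
  ultimately have Tb: "AE x in lebesgue. x \<notin> E \<longrightarrow> T b x = (\<integral>y. K x y * b y \<partial>lebesgue)" 
    by (auto elim: AE_mp)
  define F where "F x = (\<integral>\<^sup>+y. ennreal (norm (k (x, y) - k (x, y0)) * norm (b y)) \<partial>lborel)" for x
  note [measurable] = b(2)
  have k': "k \<in> borel_measurable (borel \<Otimes>\<^sub>M borel)" using k by (simp add: borel_prod)
  have kslice: "(\<lambda>y. k (x, y)) \<in> borel_measurable borel" for x using k' by measurable
  have kslice2: "(\<lambda>x. k (x, y)) \<in> borel_measurable borel" for y using k' by measurable
  have bd: "AE x in lebesgue. x \<notin> E \<longrightarrow> ennreal (norm (T b x)) \<le> F x"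
    using Tb AE_completion[OF kx]
  proof eventually_elim
    case (elim x)
    show ?case
    proof
      assume x: "x \<notin> E"
      \<comment> \<open>The two kernels are compared only off the diagonal, but \<open>x\<close>
        outside \<open>E\<close> differs from every \<open>y\<close> in the cube, and outside the
        cube \<open>b\<close> vanishes.\<close>
      have ae: "AE y in lebesgue. K x y * b y = k (x, y) * b y"
        using AE_completion[OF elim(2)]
      proof eventually_elim
        case (elim y)
        then show ?case using EE[OF x, of y] s(2)[of y] by (cases "b y = 0") auto
      qed
      have mb: "(\<lambda>y. k (x, y) * b y) \<in> borel_measurable lborel" using kslice[of x] by measurable
      then have ml: "(\<lambda>y. k (x, y) * b y) \<in> borel_measurable lebesgue" by (rule measurable_completion)
      have "T b x = (\<integral>y. K x y * b y \<partial>lebesgue)" using elim(1) x by blast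
      also have "\<dots> = (\<integral>y. k (x, y) * b y \<partial>lebesgue)"
        by (rule integral_cong_AE[OF measurable_lebesgue_AE_eq[OF ml ae] ml ae])
      also have "\<dots> = (\<integral>y. k (x, y) * b y \<partial>lborel)" by (rule integral_completion[OF mb])
      finally show "ennreal (norm (T b x)) \<le> F x"
        using norm_integral_cancel[of "\<lambda>y. k (x, y)" lborel b "k (x, y0)"] kslice[of x] b(3,4) by (simp add: F_def)
    qed
  qed
  have "(\<integral>\<^sup>+x. indicator (- E) x * ennreal (norm (T b x)) \<partial>lebesgue) \<le> (\<integral>\<^sup>+x. indicator (- E) x * F x \<partial>lebesgue)"
    by (rule nn_integral_mono_AE) (use bd in \<open>auto elim!: AE_mp simp: indicator_def\<close>)
  also have "\<dots> = (\<integral>\<^sup>+x. \<integral>\<^sup>+y. indicator (- E) x * ennreal (norm (k (x, y) - k (x, y0)) * norm (b y)) \<partial>lborel \<partial>lborel)"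
    unfolding F_def nn_integral_completion using kslice
    by (intro nn_integral_cong nn_integral_cmult[symmetric]) measurable
  also have "\<dots> = (\<integral>\<^sup>+y. \<integral>\<^sup>+x. indicator (- E) x * ennreal (norm (k (x, y) - k (x, y0)) * norm (b y)) \<partial>lborel \<partial>lborel)"
    using k' kslice2 by (intro lborel_pair.Fubini'[symmetric]) (simp add: split_beta', measurable)
  also have "\<dots> \<le> (\<integral>\<^sup>+y. ennreal A' * ennreal (norm (b y)) \<partial>lborel)"
  proof (rule nn_integral_mono_AE, use ky in eventually_elim)
    case (elim y)
    show ?case
    proof (cases "b y = 0")
      case False
      then have y: "y \<in> cube s z" by (rule s(2))
      let ?S = "{x. norm (x - y0) \<ge> 2 * norm (y0 - y)}"
      have "closed ?S" by (intro closed_Collect_le continuous_intros)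
      then have S: "?S \<inter> space lebesgue \<in> sets lebesgue" by auto
      have "(\<integral>\<^sup>+x. indicator (- E) x * ennreal (norm (k (x, y) - k (x, y0)) * norm (b y)) \<partial>lborel) = 
         (\<integral>\<^sup>+x. (indicator (- E) x * ennreal (norm (k (x, y) - k (x, y0)))) * ennreal (norm (b y)) \<partial>lborel)"
        by (simp add: ennreal_mult' mult.assoc)
      also have "\<dots> = (\<integral>\<^sup>+x. indicator (- E) x * ennreal (norm (k (x, y) - k (x, y0))) \<partial>lborel) * ennreal (norm (b y))"
        using kslice2 by (intro nn_integral_multc) measurable
      \<comment> \<open>For this \<open>y\<close> and for \<open>y0\<close> the slices of
        \<open>k\<close> agree with those of \<open>K\<close> almost everywhere off
        \<open>E\<close>, and the complement of \<open>E\<close> lies in the region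
        \<open>?S\<close> of the Hoermander condition.\<close>
      also have "(\<integral>\<^sup>+x. indicator (- E) x * ennreal (norm (k (x, y) - k (x, y0))) \<partial>lborel) \<le>
         (\<integral>\<^sup>+x. ennreal (norm (K x y0 - K x y)) * indicator ?S x \<partial>lborel)"
      proof (rule nn_integral_mono_AE, use elim ky0 in eventually_elim)
        case (elim x)
        then show ?case using EE[OF _ y, of x] EE[OF _ y0, of x] by (auto simp: indicator_def norm_minus_commute)
      qed
      also have "\<dots> = (\<integral>\<^sup>+ x. ennreal (norm (K x y0 - K x y)) \<partial>lebesgue_on ?S)"
        using S by (simp add: nn_integral_restrict_space nn_integral_completion)
      also have "\<dots> \<le> ennreal A'"
        using K(2) unfolding hoermander_condition_def Let_def by blast
      finally show ?thesis by (simp add: mult_right_mono)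
    qed auto
  qed
  also have "\<dots> = ennreal A' * (\<integral>\<^sup>+y. ennreal (norm (b y)) \<partial>lborel)"
    by (rule nn_integral_cmult) auto
  finally show thesis by (intro that[OF Em Eem])
qed

section \<open>The weak-type estimate on step functions\<close>

lemma bounded_support_in_lorentz_space:
  assumes f: "bounded_support f" "f \<in> borel_measurable lebesgue" and r: "r > 1"
  shows "f \<in> lorentz_space (ennreal r) 1"
proof -
  obtain M where M: "\<And>x. norm (f x) \<le> M" using f by (auto simp: bounded_support_def bounded_iff)
  have "integrable lebesgue f" by (rule bounded_support_integrable[OF f])
  then have "(\<integral>\<^sup>+ x. ennreal (norm (f x)) \<partial>lebesgue) < \<infinity>" by (simp add: integrable_iff_bounded)
  then obtain L where L: "(\<integral>\<^sup>+ x. ennreal (norm (f x)) \<partial>lebesgue) = ennreal L" "L \<ge> 0"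
    by (cases "\<integral>\<^sup>+ x. ennreal (norm (f x)) \<partial>lebesgue") auto
  have "M \<ge> 0" using M[of undefined] norm_ge_zero order_trans by blast
  \<comment> \<open>Adding 1 to both bounds gives strict positivity even for the zero
    function.\<close>
  then have "lorentz_norm (ennreal r) 1 f \<le>
      ennreal ((r + r / (r - 1)) * (M + 1) powr (1 - 1 / r) * (L + 1) powr (1 / r))"
    using M L by (intro lorentz_norm_one_le f r) (auto intro: order_trans[OF M] ennreal_leI)
  then show ?thesis using f by (auto simp: lorentz_space_def intro: le_less_trans)
qed

section \<open>Consequences of linearity almost everywhere\<close>

lemma linear_operator_onD:
  assumes "linear_operator_on V T" "f \<in> V"
  shows "T f \<in> borel_measurable lebesgue"
    and "g \<in> V \<Longrightarrow> AE x in lebesgue. f x = g x \<Longrightarrow> AE x in lebesgue. T f x = T g x"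
    and "g \<in> V \<Longrightarrow> AE x in lebesgue. T (\<lambda>y. f y + g y) x = T f x + T g x"
    and "AE x in lebesgue. T (\<lambda>y. c * f y) x = c * T f x"
  using assms unfolding linear_operator_on_def by simp_all

lemma linear_operator_zero:
  assumes "linear_operator_on V T" "f \<in> V"
  shows "AE x in lebesgue. T (\<lambda>_. 0) x = 0"
proof -
  have "AE x in lebesgue. T (\<lambda>y. 0 * f y) x = 0 * T f x"
    by (rule linear_operator_onD(4)[OF assms])
  then show ?thesis by simp
qed

text \<open>Additivity is applied to two summands at a time, so all partial sums must lie in
  \<open>V\<close>. Bounded support guarantees this without a triangle inequality for the Lorentz
  quasi-norm.\<close>

lemma linear_operator_sum:
  assumes T: "linear_operator_on V T" and "finite I"
    and V: "\<And>f. bounded_support f \<Longrightarrow> f \<in> borel_measurable lebesgue \<Longrightarrow> f \<in> V"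
    and f: "\<And>i. i \<in> I \<Longrightarrow> bounded_support (f i)" "\<And>i. i \<in> I \<Longrightarrow> f i \<in> borel_measurable lebesgue"
  shows "AE x in lebesgue. T (\<lambda>y. \<Sum>i\<in>I. f i y) x = (\<Sum>i\<in>I. T (f i) x)"
  using \<open>finite I\<close> f
proof (induction I rule: finite_induct)
  case empty
  have "(\<lambda>_. 0) \<in> V" by (rule V) (auto simp: bounded_support_def)
  then show ?case using linear_operator_zero[OF T] by simp
next
  case (insert i I)
  have fi: "f i \<in> V" using insert by (intro V) auto
  have fI: "(\<lambda>y. \<Sum>i\<in>I. f i y) \<in> V" using insert by (intro V bounded_support_sum borel_measurable_sum) auto
  have "AE x in lebesgue. T (\<lambda>y. f i y + (\<Sum>i\<in>I. f i y)) x = T (f i) x + T (\<lambda>y. \<Sum>i\<in>I. f i y) x"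
    by (rule linear_operator_onD(3)[OF T fi fI])
  moreover have "AE x in lebesgue. T (\<lambda>y. \<Sum>i\<in>I. f i y) x = (\<Sum>i\<in>I. T (f i) x)"
    using insert by auto
  ultimately show ?case
    by eventually_elim (use insert(1,2) in simp)
qed

text \<open>The summands bound, in this order, the contributions of the good part, of the dilated
  cubes and of the bad parts.\<close>

definition cz_const :: "real \<Rightarrow> nat \<Rightarrow> real" where
  "cz_const r n = (2 * (r + r / (r - 1))) powr r * (2 ^ n) powr (r - 1) + (4 * real n) ^ n + 4"

lemma cz_const_pos: "cz_const r n > 0"
  unfolding cz_const_def by (smt (verit) powr_ge_zero mult_nonneg_nonneg zero_le_power of_nat_0_le_iff)

text \<open>With height \<open>l / D\<close> the powers cancel:
  \<open>D powr r * (l / D) powr (r - 1) * L / l powr r\<close> is \<open>D * L / l\<close>, linear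
  in \<open>D\<close>. In the application \<open>c\<close> is the constant of the Lorentz bound and
  \<open>N\<close> is the \<open>2 ^ n\<close> from the parent cubes.\<close>

lemma good_part_arithmetic:
  fixes r c L D B l N :: real
  assumes r: "r > 1" and pos: "c > 0" "L > 0" "D > 0" "B \<ge> 0" "l > 0" "N > 0" and BD: "B \<le> D"
  shows "(B * (c * (N * (l / D)) powr (1 - 1 / r) * L powr (1 / r)) / (l / 2)) powr r
     \<le> (2 * c) powr r * N powr (r - 1) * (D * L / l)"
proof -
  have e: "(1 - 1 / r) * r = r - 1" using r by (simp add: field_simps)
  have "(B * (c * (N * (l / D)) powr (1 - 1 / r) * L powr (1 / r)) / (l / 2)) powr r
     \<le> (D * (c * (N * (l / D)) powr (1 - 1 / r) * L powr (1 / r)) / (l / 2)) powr r"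
    using assms by (intro powr_mono2 divide_right_mono mult_right_mono) auto
  also have "\<dots> = (2 * c) powr r * N powr (r - 1) * (D powr r * (l / D) powr (r - 1) * L / l powr r)"
    using pos r by (simp add: powr_mult powr_divide powr_powr e)
  also have "D powr r * (l / D) powr (r - 1) * L / l powr r = D * L / l"
    using pos by (simp add: powr_divide powr_diff)
  finally show ?thesis .
qed

text \<open>Up to a null set three sets cover the level set: where \<open>T g\<close> exceeds
  \<open>l / 2\<close>, the union of the balls around the cubes, and where the norms of the bad
  images sum to at least \<open>l / 2\<close> outside these balls.\<close>

lemma weak_type_step_function:
  fixes T :: "(real ^ 'n::finite \<Rightarrow> complex) \<Rightarrow> (real ^ 'n \<Rightarrow> complex)"
  assumes r: "r > 1" and T: "linear_operator_on (lorentz_space (ennreal r) 1) T"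
    and K: "associated_kernel (lorentz_space (ennreal r) 1) T K" "hoermander_condition K A'"
    and A': "A' > 0" and B: "B \<ge> 0"
      "\<And>f. f \<in> lorentz_space (ennreal r) 1 \<Longrightarrow> lorentz_norm (ennreal r) \<infinity> (T f) \<le> ennreal B * lorentz_norm (ennreal r) 1 f"
    and f: "step_function h f" "h > 0" and l: "l > 0"
  shows "emeasure lebesgue {x. norm (T f x) > l} \<le>
    ennreal (cz_const r CARD('n) * (A' + B) * (\<integral>x. norm (f x) \<partial>lborel) / l)"
proof -
  let ?V = "lorentz_space (ennreal r) 1 :: (real ^ 'n \<Rightarrow> complex) set"
  define D where "D = A' + B"
  define n where "n = CARD('n)"
  have D: "D > 0" "B \<le> D" "A' \<le> D" using A' B by (auto simp: D_def)
  define \<alpha> where "\<alpha> = l / D"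
  have \<alpha>: "\<alpha> > 0" using D l by (simp add: \<alpha>_def)
  obtain \<Q> g b where fin: "finite \<Q>" and cu: "\<And>Q. Q \<in> \<Q> \<Longrightarrow> \<exists>s>0. \<exists>x. Q = cube s x"
    and total: "\<alpha> * (\<Sum>Q\<in>\<Q>. measure lborel Q) \<le> (\<integral>x. norm (f x) \<partial>lborel)"
    and fg: "\<And>x. f x = g x + (\<Sum>Q\<in>\<Q>. b Q x)"
    and g: "g \<in> borel_measurable borel" "bounded_support g" "\<And>x. norm (g x) \<le> 2 ^ CARD('n) * \<alpha>"
    "(\<integral>x. norm (g x) \<partial>lborel) \<le> (\<integral>x. norm (f x) \<partial>lborel)"
    and bm: "\<And>Q. Q \<in> \<Q> \<Longrightarrow> b Q \<in> borel_measurable borel"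
    and bb: "\<And>Q. Q \<in> \<Q> \<Longrightarrow> bounded_support (b Q)"
    and bs: "\<And>Q x. Q \<in> \<Q> \<Longrightarrow> b Q x \<noteq> 0 \<Longrightarrow> x \<in> Q"
    and b0: "\<And>Q. Q \<in> \<Q> \<Longrightarrow> (\<integral>x. b Q x \<partial>lborel) = 0"
    and btot: "(\<Sum>Q\<in>\<Q>. \<integral>x. norm (b Q x) \<partial>lborel) \<le> 2 * (\<integral>x. norm (f x) \<partial>lborel)"
    by (rule cz_decomposition[OF f \<alpha>]; rule that; assumption)
  have V: "u \<in> ?V" if "bounded_support u" "u \<in> borel_measurable lebesgue" for u
    using that r by (rule bounded_support_in_lorentz_space)
  have Tm: "T u \<in> borel_measurable lebesgue" if "u \<in> ?V" for u
    by (rule linear_operator_onD(1)[OF T that])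
  have gV: "g \<in> ?V" using g by (intro V measurable_completion) auto
  have bV: "b Q \<in> ?V" if "Q \<in> \<Q>" for Q using bm bb that by (intro V measurable_completion) auto
  have fV: "f \<in> ?V"
    using step_function_borel[OF f(1)] step_function_bounded_support[OF f(1)] by (intro V measurable_completion) auto
  have bi: "integrable lborel (b Q)" if "Q \<in> \<Q>" for Q
    using bounded_support_integrable[OF bb[OF that]] bm[OF that]
    by (simp add: integrable_completion measurable_completion)
  have gi: "integrable lborel g"
    using bounded_support_integrable[OF g(2)] g(1) by (simp add: integrable_completion measurable_completion)
  define P where "P Q E \<longleftrightarrow> E \<in> sets borel \<and> emeasure lborel E \<le> ennreal ((4 * real n) ^ n * measure lborel Q) \<and>
    (\<integral>\<^sup>+x. indicator (- E) x * ennreal (norm (T (b Q) x)) \<partial>lebesgue) \<le> ennreal (A' * (\<integral>y. norm (b Q y) \<partial>lborel))" for Q E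
  have "\<exists>E. P Q E"
    if Q: "Q \<in> \<Q>" for Q
  proof -
    obtain s z where s: "s > 0" "Q = cube s z" using cu[OF Q] by auto
    obtain E where E: "E \<in> sets borel" "emeasure lborel E \<le> ennreal ((4 * real CARD('n) * s) ^ CARD('n))"
      "(\<integral>\<^sup>+x. indicator (- E) x * ennreal (norm (T (b Q) x)) \<partial>lebesgue) \<le> ennreal A' * (\<integral>\<^sup>+y. ennreal (norm (b Q y)) \<partial>lborel)"
      by (rule kernel_cancellation[OF K bV[OF Q] bm[OF Q] bi[OF Q] b0[OF Q] s(1), of z]) (use bs[OF Q] s(2) in auto)
    have "(\<integral>\<^sup>+y. ennreal (norm (b Q y)) \<partial>lborel) = ennreal (\<integral>y. norm (b Q y) \<partial>lborel)"
      using bi[OF Q] by (intro nn_integral_eq_integral) auto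
    then show ?thesis unfolding P_def using E s A' by (intro exI[of _ E]) (auto simp: measure_cube n_def power_mult_distrib ennreal_mult')
  qed
  then obtain E where "\<forall>Q\<in>\<Q>. P Q (E Q)" using bchoice[of \<Q> P] by blast
  then have E: "\<And>Q. Q \<in> \<Q> \<Longrightarrow> E Q \<in> sets borel" 
    "\<And>Q. Q \<in> \<Q> \<Longrightarrow> emeasure lborel (E Q) \<le> ennreal ((4 * real n) ^ n * measure lborel Q)"
    "\<And>Q. Q \<in> \<Q> \<Longrightarrow> (\<integral>\<^sup>+x. indicator (- E Q) x * ennreal (norm (T (b Q) x)) \<partial>lebesgue) \<le> ennreal (A' * (\<integral>y. norm (b Q y) \<partial>lborel))"
    unfolding P_def by auto
  define U where "U = (\<Union>Q\<in>\<Q>. E Q)"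
  have Um: "U \<in> sets borel" unfolding U_def using fin E by (intro sets.finite_UN) auto
  then have Ul: "U \<in> sets lebesgue" by (metis sets_completionI_sets sets_lborel)
  define G where "G = {x. norm (T g x) > l / 2}"
  \<comment> \<open>The third set, cut off outside \<open>U\<close> and normalised to the form of
    Markov's inequality.\<close>
  define H where "H = {x \<in> space lebesgue. 1 \<le> ennreal (2 / l) * (indicator (- U) x * (\<Sum>Q\<in>\<Q>. ennreal (norm (T (b Q) x))))}"
  have Gm: "G \<in> sets lebesgue" unfolding G_def by (intro level_set_measurable Tm gV)
  have Um': "- U \<in> sets lebesgue" using Um borel_comp by auto
  have Sm: "(\<lambda>x. indicator (- U) x * (\<Sum>Q\<in>\<Q>. ennreal (norm (T (b Q) x)))) \<in> borel_measurable lebesgue"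
    using Um' Tm bV by (intro borel_measurable_times_ennreal borel_measurable_indicator borel_measurable_sum) auto
  then have Hm: "H \<in> sets lebesgue" unfolding H_def by measurable
  \<comment> \<open>\<open>L\<close> is a positive majorant of the mass, because the Lorentz bound
    is stated for \<open>L > 0\<close> and the mass may vanish.\<close>
  have main: "emeasure lebesgue {x. norm (T f x) > l} \<le> ennreal (cz_const r n * D * L / l)"
    if L: "L > 0" "(\<integral>x. norm (f x) \<partial>lborel) \<le> L" for L
  proof -
    have "emeasure lebesgue {x. norm (T f x) > l} \<le> emeasure lebesgue (G \<union> U \<union> H)"
    proof (rule emeasure_mono_AE)
      have "AE x in lebesgue. T (\<lambda>y. g y + (\<Sum>Q\<in>\<Q>. b Q y)) x = T g x + T (\<lambda>y. \<Sum>Q\<in>\<Q>. b Q y) x"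
        using bb bm by (intro linear_operator_onD(3)[OF T gV] V bounded_support_sum measurable_completion) auto
      moreover have "AE x in lebesgue. T (\<lambda>y. \<Sum>Q\<in>\<Q>. b Q y) x = (\<Sum>Q\<in>\<Q>. T (b Q) x)"
        using bb bm by (intro linear_operator_sum[OF T fin V]) (auto intro: measurable_completion)
      ultimately show "AE x in lebesgue. x \<in> {x. norm (T f x) > l} \<longrightarrow> x \<in> G \<union> U \<union> H"
      proof eventually_elim
        case (elim x)
        have Tf: "T f x = T g x + (\<Sum>Q\<in>\<Q>. T (b Q) x)" using elim fg by presburger
        show ?case
        proof
          assume "x \<in> {x. norm (T f x) > l}"
          show "x \<in> G \<union> U \<union> H"
          proof (rule ccontr)
            assume "x \<notin> G \<union> U \<union> H"
            with \<open>x \<in> {x. norm (T f x) > l}\<close> have a: "l < norm (T f x)" "x \<notin> H" "x \<notin> U" "x \<notin> G" by auto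
            from a(4) have "norm (T g x) \<le> l / 2" by (simp add: G_def)
            moreover have "norm (\<Sum>Q\<in>\<Q>. T (b Q) x) \<le> (\<Sum>Q\<in>\<Q>. norm (T (b Q) x))" by (rule norm_sum)
            ultimately have "l / 2 \<le> (\<Sum>Q\<in>\<Q>. norm (T (b Q) x))"
              using a(1) norm_triangle_ineq[of "T g x" "\<Sum>Q\<in>\<Q>. T (b Q) x"] unfolding Tf by linarith
            then have "1 \<le> (2 / l) * (\<Sum>Q\<in>\<Q>. norm (T (b Q) x))" using l by (simp add: field_simps)
            then have "x \<in> H" using a(3) l
              by (simp add: H_def sum_ennreal flip: ennreal_mult')
            with a show False by simp
          qed
        qed
      qed
    qed (intro sets.Un Gm Hm Ul)
    also have "\<dots> \<le> emeasure lebesgue G + emeasure lebesgue U + emeasure lebesgue H"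
      using Gm Hm Ul by (intro order_trans[OF emeasure_subadditive] add_right_mono emeasure_subadditive sets.Un) auto
    also have "\<dots> \<le> ennreal ((2 * (r + r / (r - 1))) powr r * (2 ^ n) powr (r - 1) * (D * L / l)) + 
        ennreal ((4 * real n) ^ n * (D * L / l)) + ennreal (4 * (D * L / l))"
    proof (intro add_mono)
      define c where "c = r + r / (r - 1)"
      have c: "c > 0" using r by (auto simp: c_def intro: add_pos_pos)
      have "(\<integral>\<^sup>+x. ennreal (norm (g x)) \<partial>lborel) = ennreal (\<integral>x. norm (g x) \<partial>lborel)"
        using gi by (intro nn_integral_eq_integral) auto
      also have "\<dots> \<le> ennreal L" using g(4) L by (intro ennreal_leI) auto
      finally have "(\<integral>\<^sup>+x. ennreal (norm (g x)) \<partial>lebesgue) \<le> ennreal L" by (simp add: nn_integral_completion)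
      then have "lorentz_norm (ennreal r) 1 g \<le> ennreal (c * (2 ^ n * \<alpha>) powr (1 - 1 / r) * L powr (1 / r))"
        unfolding c_def using g r \<alpha> L by (intro lorentz_norm_one_le) (auto simp: n_def intro: measurable_completion)
      then have "ennreal B * lorentz_norm (ennreal r) 1 g \<le> ennreal B * ennreal (c * (2 ^ n * \<alpha>) powr (1 - 1 / r) * L powr (1 / r))"
        by (rule mult_left_mono) auto
      then have "lorentz_norm (ennreal r) \<infinity> (T g) \<le> ennreal (B * (c * (2 ^ n * \<alpha>) powr (1 - 1 / r) * L powr (1 / r)))"
        using B(1) order_trans[OF B(2)[OF gV]] by (simp add: ennreal_mult')
      then have "emeasure lebesgue G \<le> ennreal ((B * (c * (2 ^ n * \<alpha>) powr (1 - 1 / r) * L powr (1 / r)) / (l / 2)) powr r)"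
        unfolding G_def using r l B(1) c by (intro emeasure_le_of_weak_lorentz Tm gV) auto
      also have "\<dots> \<le> ennreal ((2 * c) powr r * (2 ^ n) powr (r - 1) * (D * L / l))"
        unfolding \<alpha>_def by (intro ennreal_leI good_part_arithmetic) (use r c L D B l in auto)
      finally show "emeasure lebesgue G \<le> ennreal ((2 * (r + r / (r - 1))) powr r * (2 ^ n) powr (r - 1) * (D * L / l))"
        by (simp add: c_def)
      have "emeasure lborel U \<le> (\<Sum>Q\<in>\<Q>. emeasure lborel (E Q))"
        unfolding U_def using fin E by (intro emeasure_subadditive_finite) auto
      also have "\<dots> \<le> (\<Sum>Q\<in>\<Q>. ennreal ((4 * real n) ^ n * measure lborel Q))" using E(2) by (rule sum_mono)
      also have "\<dots> = ennreal ((4 * real n) ^ n * (\<Sum>Q\<in>\<Q>. measure lborel Q))"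
        by (subst sum_ennreal) (auto simp: sum_distrib_left)
      also have "\<dots> \<le> ennreal ((4 * real n) ^ n * (D * L / l))"
      proof (intro ennreal_leI mult_left_mono)
        have "\<alpha> * (\<Sum>Q\<in>\<Q>. measure lborel Q) \<le> L" using total L by simp
        then show "(\<Sum>Q\<in>\<Q>. measure lborel Q) \<le> D * L / l" using l D by (simp add: \<alpha>_def field_simps)
      qed auto
      finally show "emeasure lebesgue U \<le> ennreal ((4 * real n) ^ n * (D * L / l))" using Um by simp
      have "emeasure lebesgue H \<le> ennreal (2 / l) * (\<integral>\<^sup>+x. indicator (- U) x * (\<Sum>Q\<in>\<Q>. ennreal (norm (T (b Q) x))) * indicator (space lebesgue) x \<partial>lebesgue)"
        unfolding H_def using Sm by (intro nn_integral_Markov_inequality) auto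
      also have "\<dots> \<le> ennreal (2 / l) * (\<integral>\<^sup>+x. (\<Sum>Q\<in>\<Q>. indicator (- E Q) x * ennreal (norm (T (b Q) x))) \<partial>lebesgue)"
        by (intro mult_left_mono nn_integral_mono) (auto simp: U_def indicator_def intro!: sum_mono)
      also have "\<dots> = ennreal (2 / l) * (\<Sum>Q\<in>\<Q>. \<integral>\<^sup>+x. indicator (- E Q) x * ennreal (norm (T (b Q) x)) \<partial>lebesgue)"
      proof (subst nn_integral_sum)
        fix Q assume Q: "Q \<in> \<Q>"
        have "- E Q \<in> sets lebesgue" using E(1)[OF Q] borel_comp by auto
        then show "(\<lambda>x. indicator (- E Q) x * ennreal (norm (T (b Q) x))) \<in> borel_measurable lebesgue"
          using Tm[OF bV[OF Q]] by (intro borel_measurable_times_ennreal borel_measurable_indicator) auto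
      qed simp
      also have "\<dots> \<le> ennreal (2 / l) * (\<Sum>Q\<in>\<Q>. ennreal (A' * (\<integral>y. norm (b Q y) \<partial>lborel)))"
        using E(3) by (intro mult_left_mono sum_mono) auto
      also have "(\<Sum>Q\<in>\<Q>. ennreal (A' * (\<integral>y. norm (b Q y) \<partial>lborel))) = ennreal (A' * (\<Sum>Q\<in>\<Q>. \<integral>y. norm (b Q y) \<partial>lborel))"
        using A' by (subst sum_ennreal) (auto simp: sum_distrib_left)
      also have "ennreal (2 / l) * \<dots> = ennreal ((2 / l) * (A' * (\<Sum>Q\<in>\<Q>. \<integral>y. norm (b Q y) \<partial>lborel)))"
        by (rule ennreal_mult'[symmetric]) (use l in simp)
      \<comment> \<open>One factor 2 comes from the height \<open>l / 2\<close>, the other from the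
        total mass \<open>2 * L\<close> of the bad parts.\<close>
      also have "\<dots> \<le> ennreal ((2 / l) * (D * (2 * L)))"
        using btot L A' D l by (intro ennreal_leI mult_left_mono mult_mono) (auto intro!: sum_nonneg)
      also have "(2 / l) * (D * (2 * L)) = 4 * (D * L / l)" by simp
      finally show "emeasure lebesgue H \<le> ennreal (4 * (D * L / l))" .
    qed
    also have "\<dots> = ennreal (cz_const r n * D * L / l)"
      using D L l by (simp add: cz_const_def algebra_simps add_divide_distrib flip: ennreal_plus)
    finally show ?thesis .
  qed
  have C: "cz_const r n > 0" by (rule cz_const_pos)
  show ?thesis
  proof (rule ennreal_le_epsilon)
    fix e :: real assume e: "e > 0"
    define L where "L = (\<integral>x. norm (f x) \<partial>lborel)"
    have L0: "L \<ge> 0" by (simp add: L_def)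
    \<comment> \<open>Enlarging the mass by \<open>\<delta>\<close> raises the bound by exactly
      \<open>e\<close>.\<close>
    define \<delta> where "\<delta> = e * l / (cz_const r n * D)"
    have "\<delta> > 0" using e l C D by (simp add: \<delta>_def)
    then have "emeasure lebesgue {x. norm (T f x) > l} \<le> ennreal (cz_const r n * D * (L + \<delta>) / l)"
      using L0 by (intro main) (auto simp flip: L_def)
    also have "cz_const r n * D * (L + \<delta>) / l = cz_const r n * D * L / l + e"
      using C D l by (simp add: \<delta>_def field_simps)
    also have "ennreal \<dots> = ennreal (cz_const r n * D * L / l) + ennreal e"
      using C D l e L0 by (intro ennreal_plus) auto
    finally show "emeasure lebesgue {x. norm (T f x) > l} \<le> 
       ennreal (cz_const r CARD('n) * (A' + B) * (\<integral>x. norm (f x) \<partial>lborel) / l) + ennreal e"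
      by (simp add: L_def D_def n_def)
  qed
qed

section \<open>Approximation by dyadic step functions\<close>

text \<open>Meshes \<open>1 / 2 ^ k\<close> have common refinements, so sums stay in the class;
  incommensurable meshes would not guarantee this.\<close>

definition dyadic_step :: "(real ^ 'n::finite \<Rightarrow> complex) set" where
  "dyadic_step = {f. \<exists>k::nat. step_function (1 / 2 ^ k) f}"

lemma dyadic_step_bounded_support: "f \<in> dyadic_step \<Longrightarrow> bounded_support f"
  by (auto simp: dyadic_step_def step_function_def)

lemma dyadic_step_borel: "f \<in> dyadic_step \<Longrightarrow> f \<in> borel_measurable borel"
  by (auto simp: dyadic_step_def intro: step_function_borel)

lemma dyadic_step_measurable: "f \<in> dyadic_step \<Longrightarrow> f \<in> borel_measurable lebesgue"
  by (intro measurable_completion) (simp add: dyadic_step_borel)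

lemma step_function_dyadic_mono:
  assumes "step_function (1 / 2 ^ k) f" "k \<le> m"
  shows "step_function (1 / 2 ^ m) f"
proof (rule step_function_refine)
  have "2 ^ (m - k) * (1 / 2 ^ m) = (1 / 2 ^ k :: real)" using assms(2) by (simp add: power_diff)
  then show "step_function (2 ^ (m - k) * (1 / 2 ^ m)) f" using assms(1) by simp
qed

lemma dyadic_step_add:
  assumes "f \<in> dyadic_step" "g \<in> dyadic_step"
  shows "(\<lambda>x. f x + g x) \<in> dyadic_step"
proof -
  obtain k m where *: "step_function (1 / 2 ^ k) f" "step_function (1 / 2 ^ m) g"
    using assms by (auto simp: dyadic_step_def)
  have "step_function (1 / 2 ^ max k m) (\<lambda>x. f x + g x)"
    by (rule step_function_add[OF step_function_dyadic_mono[OF *(1) max.cobounded1]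
          step_function_dyadic_mono[OF *(2) max.cobounded2]])
  then show ?thesis by (auto simp: dyadic_step_def)
qed

lemma dyadic_step_cmult: "f \<in> dyadic_step \<Longrightarrow> (\<lambda>x. c * f x) \<in> dyadic_step"
  by (auto simp: dyadic_step_def intro: step_function_cmult)

text \<open>A sampling point for each cell: composing any function with \<open>corner h\<close>
  makes it constant on the cells of mesh \<open>h\<close>.\<close>

definition corner :: "real \<Rightarrow> real ^ 'n::finite \<Rightarrow> real ^ 'n" where
  "corner h x = (\<chi> i. h * of_int \<lfloor>x $ i / h\<rfloor>)"

lemma corner_in_cube: "h > 0 \<Longrightarrow> corner h x \<in> cube h x"
  by (simp add: corner_def cube_def)

lemma corner_cong: "y \<in> cube h x \<Longrightarrow> corner h y = corner h x"
  by (simp add: corner_def cube_def)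

lemma continuous_corner_approx:
  fixes g :: "real ^ 'n::finite \<Rightarrow> complex"
  assumes g: "continuous_on UNIV g" and e: "e > 0"
  shows "\<exists>k. \<forall>x. norm x \<le> R \<longrightarrow> norm (g (corner (1 / 2 ^ k) x) - g x) < e"
proof -
  have "uniformly_continuous_on (cball 0 (R + 1)) g"
    by (intro compact_uniformly_continuous continuous_on_subset[OF g]) auto
  then obtain d where d: "d > 0" "\<And>x y. x \<in> cball 0 (R + 1) \<Longrightarrow> y \<in> cball 0 (R + 1) \<Longrightarrow> dist y x < d \<Longrightarrow> dist (g y) (g x) < e"
    using e unfolding uniformly_continuous_on_def by metis
  \<comment> \<open>The displacement must be below \<open>d\<close> for uniform continuity, and
    below 1 to keep the sampling point in the ball of radius \<open>R + 1\<close>.\<close>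
  obtain k where "(1 / 2) ^ k < min d 1 / real CARD('n)"
    using real_arch_pow_inv[of "min d 1 / real CARD('n)" "1 / 2"] d by auto
  then have k: "real CARD('n) * (1 / 2 ^ k) < min d 1"
    by (simp add: field_simps power_one_over)
  have "norm (g (corner (1 / 2 ^ k) x) - g x) < e" if x: "norm x \<le> R" for x
  proof -
    have "norm (corner (1 / 2 ^ k) x - x) \<le> real CARD('n) * (1 / 2 ^ k)"
      by (intro cube_norm_diff corner_in_cube) auto
    then have n: "norm (corner (1 / 2 ^ k) x - x) < min d 1" using k by linarith
    have "norm (corner (1 / 2 ^ k) x) \<le> norm x + norm (corner (1 / 2 ^ k) x - x)"
      by (rule norm_triangle_sub)
    then show ?thesis using d(2)[of x "corner (1 / 2 ^ k) x"] x n by (simp add: dist_norm)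
  qed
  then show ?thesis by blast
qed

text \<open>Measurability provides continuous functions tending to \<open>f\<close> almost
  everywhere. Clipping, sampling at corners and cutting off turn them into step functions with a
  common bound and a common support, ready for dominated convergence.\<close>

lemma bounded_support_dyadic_limit:
  fixes f :: "real ^ 'n::finite \<Rightarrow> complex"
  assumes fm: "f \<in> borel_measurable lebesgue" and f: "bounded_support f"
  obtains s M R where "\<And>j::nat. s j \<in> dyadic_step" "\<And>j x. norm (s j x) \<le> M" "\<And>j x. s j x \<noteq> 0 \<Longrightarrow> norm x \<le> R"
    "AE x in lebesgue. (\<lambda>j. s j x) \<longlonglongrightarrow> f x" "\<And>x. norm (f x) \<le> M" "\<And>x. f x \<noteq> 0 \<Longrightarrow> norm x \<le> R"
proof -
  obtain M' where M': "\<And>x. norm (f x) \<le> M'" using f by (auto simp: bounded_support_def bounded_iff)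
  define M where "M = max M' 1"
  have M: "norm (f x) \<le> M" "M > 0" for x using M'[of x] by (auto simp: M_def)
  obtain R0 where R0: "\<And>x. f x \<noteq> 0 \<Longrightarrow> norm x \<le> R0" using f by (auto simp: bounded_support_def bounded_iff)
  \<comment> \<open>A union of unit cells, so that cutting off with \<open>S\<close> respects all
    finer dyadic cells.\<close>
  define S where "S = {x :: real ^ 'n. \<exists>y\<in>cube 1 x. norm y \<le> R0}"
  define R where "R = R0 + real CARD('n)"
  have SR: "norm x \<le> R" if "x \<in> S" for x
  proof -
    obtain y where y: "y \<in> cube 1 x" "norm y \<le> R0" using \<open>x \<in> S\<close> by (auto simp: S_def)
    then have "norm (y - x) \<le> real CARD('n)" using cube_norm_diff[of 1 y x] by simp
    then show ?thesis using norm_triangle_sub[of x y] y by (simp add: R_def norm_minus_commute)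
  qed
  have fS: "x \<in> S" if "f x \<noteq> 0" for x using R0[OF that] cube_self[of x 1] by (auto simp: S_def)
  have S_cong: "y \<in> S \<longleftrightarrow> x \<in> S" if "y \<in> cube (1 / 2 ^ k) x" for x y k
  proof -
    have "cube (1 / 2 ^ k) x \<subseteq> cube 1 x" using cube_power_subset[of 0 k "1 / 2 ^ k" x] by simp
    then show ?thesis using that cube_eq[of y 1 x] by (auto simp: S_def)
  qed
  have "f measurable_on UNIV" using fm by (intro lebesgue_measurable_imp_measurable_on) auto
  then obtain N g where N: "negligible N" and g: "\<And>j::nat. continuous_on UNIV (g j)"
    and lim: "\<And>x. x \<notin> N \<Longrightarrow> (\<lambda>j. g j x) \<longlonglongrightarrow> f x"
    unfolding measurable_on_def by auto
  \<comment> \<open>Nearest-point projection onto the disc of radius \<open>M\<close>: it is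
    continuous and fixes the values of \<open>f\<close>, so clipping does not change the
    limit.\<close>
  define clip where "clip = closest_point (cball (0 :: complex) M)"
  have clip: "norm (clip z) \<le> M" "norm z \<le> M \<Longrightarrow> clip z = z" for z
    using closest_point_in_set[of "cball 0 M" z] closest_point_self[of z "cball 0 M"] M by (auto simp: clip_def)
  have clip_cont: "continuous_on UNIV clip"
    unfolding clip_def using M by (intro continuous_on_closest_point) auto
  have gc: "continuous_on UNIV (\<lambda>x. clip (g j x))" for j
    by (rule continuous_on_compose2[OF clip_cont g]) auto
  \<comment> \<open>The mesh depends on \<open>j\<close>: each clipped function gets its own, with a
    sampling error uniform on a ball that contains \<open>S\<close>.\<close>
  have "\<forall>j. \<exists>k. \<forall>x. norm x \<le> R \<longrightarrow> norm (clip (g j (corner (1 / 2 ^ k) x)) - clip (g j x)) < 1 / real (Suc j)"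
    using continuous_corner_approx[OF gc] by simp
  then obtain k where k: "\<And>j x. norm x \<le> R \<Longrightarrow> norm (clip (g j (corner (1 / 2 ^ k j) x)) - clip (g j x)) < 1 / real (Suc j)"
    by metis
  define s where "s j x = (if x \<in> S then clip (g j (corner (1 / 2 ^ k j) x)) else 0)" for j x
  show thesis
  proof (rule that[of s M R])
    show sM: "norm (s j x) \<le> M" for j x using clip M by (simp add: s_def)
    show sR: "norm x \<le> R" if "s j x \<noteq> 0" for j x using that SR by (auto simp: s_def split: if_splits)
    show "s j \<in> dyadic_step" for j
    proof -
      have "bounded {x. s j x \<noteq> 0}" using sR by (auto simp: bounded_iff)
      moreover have "bounded (range (s j))" using sM by (auto simp: bounded_iff)
      moreover have "s j y = s j x" if "y \<in> cube (1 / 2 ^ k j) x" for x y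
        using S_cong[OF that] corner_cong[OF that] by (simp add: s_def)
      ultimately show ?thesis by (auto simp: dyadic_step_def step_function_def bounded_support_def)
    qed
    show "norm x \<le> R" if "f x \<noteq> 0" for x using SR[OF fS[OF that]] .
    have "AE x in lebesgue. x \<notin> N" using N by (simp add: negligible_iff_null_sets AE_not_in)
    then show "AE x in lebesgue. (\<lambda>j. s j x) \<longlonglongrightarrow> f x"
    proof eventually_elim
      case (elim x)
      show ?case
      proof (cases "x \<in> S")
        case True
        have "(\<lambda>j. clip (g j x)) \<longlonglongrightarrow> clip (f x)"
          by (rule continuous_on_tendsto_compose[OF clip_cont lim[OF elim]]) auto
        then have 1: "(\<lambda>j. clip (g j x)) \<longlonglongrightarrow> f x" using clip M by simp
        have "(\<lambda>j. s j x - clip (g j x)) \<longlonglongrightarrow> 0"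
        proof (rule Lim_null_comparison)
          show "(\<lambda>j. 1 / real (Suc j)) \<longlonglongrightarrow> 0" using LIMSEQ_inverse_real_of_nat by (simp add: inverse_eq_divide)
          show "\<forall>\<^sub>F j in sequentially. norm (s j x - clip (g j x)) \<le> 1 / real (Suc j)"
            using k[OF SR[OF True]] True by (auto simp: s_def less_imp_le)
        qed
        from tendsto_add[OF this 1] show ?thesis by simp
      next
        case False
        then have "f x = 0" using fS by blast
        with False show ?thesis by (simp add: s_def)
      qed
    qed
  qed (rule M)
qed

text \<open>One sequence serves both norms: the differences are uniformly bounded, and under such a
  bound the Lorentz norm is controlled by a power of the integral.\<close>

lemma bounded_support_dyadic_approx:
  fixes f :: "real ^ 'n::finite \<Rightarrow> complex"
  assumes fm: "f \<in> borel_measurable lebesgue" and f: "bounded_support f" and r: "r > 1" and e: "e > 0"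
  obtains s where "s \<in> dyadic_step" "(\<integral>x. norm (f x - s x) \<partial>lebesgue) < e"
    "lorentz_norm (ennreal r) 1 (\<lambda>x. f x - s x) \<le> ennreal e"
proof -
  obtain s M R where s: "\<And>j::nat. s j \<in> dyadic_step" "\<And>j x. norm (s j x) \<le> M" "\<And>j x. s j x \<noteq> 0 \<Longrightarrow> norm x \<le> R"
    "AE x in lebesgue. (\<lambda>j. s j x) \<longlonglongrightarrow> f x" "\<And>x. norm (f x) \<le> M" "\<And>x. f x \<noteq> 0 \<Longrightarrow> norm x \<le> R"
    by (rule bounded_support_dyadic_limit[OF fm f]; rule that; assumption)
  define M2 where "M2 = 2 * M + 1"
  have "M \<ge> 0" using s(5)[of 0] norm_ge_zero order_trans by blast
  then have M2: "M2 > 0" by (simp add: M2_def)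
  have sm: "s j \<in> borel_measurable lebesgue" for j using s(1) by (rule dyadic_step_measurable)
  have bound: "norm (f x - s j x) \<le> M2 * indicator (cball 0 R) x" for j x
  proof (cases "norm x \<le> R")
    case True
    have "norm (f x - s j x) \<le> M + M" using s(2,5) norm_triangle_le_diff add_mono by meson
    then show ?thesis using True by (simp add: M2_def)
  next
    case False
    then have "f x = 0" "s j x = 0" using s(3,6) by blast+
    then show ?thesis using False by simp
  qed
  have iM: "integrable lebesgue (\<lambda>x. M2 * indicator (cball 0 R) (x :: real ^ 'n))"
    by (intro integrable_mult_right integrable_real_indicator) (use emeasure_bounded_finite[OF bounded_cball] in auto)
  have "(\<lambda>j. \<integral>x. norm (f x - s j x) \<partial>lebesgue) \<longlonglongrightarrow> (\<integral>x. 0 \<partial>(lebesgue :: (real ^ 'n) measure))"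
  proof (rule integral_dominated_convergence[OF _ _ iM])
    show "AE x in lebesgue. (\<lambda>j. norm (f x - s j x)) \<longlonglongrightarrow> 0"
      using s(4)
    proof eventually_elim
      case (elim x)
      have "(\<lambda>j. norm (f x - s j x)) \<longlonglongrightarrow> norm (f x - f x)" using elim by (intro tendsto_intros)
      then show ?case by simp
    qed
  qed (use bound fm sm in auto)
  then have lim: "(\<lambda>j. \<integral>x. norm (f x - s j x) \<partial>lebesgue) \<longlonglongrightarrow> 0" by simp
  define c where "c = (r + r / (r - 1)) * M2 powr (1 - 1 / r)"
  have c: "c > 0" using r M2 by (auto simp: c_def intro!: mult_pos_pos add_pos_pos)
  \<comment> \<open>Chosen so that \<open>c * L powr (1 / r)\<close> equals
    \<open>e\<close>.\<close>
  define L where "L = (e / c) powr r"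
  have L: "L > 0" "L powr (1 / r) = e / c" using c e r by (auto simp: L_def powr_powr)
  have "\<forall>\<^sub>F j in sequentially. (\<integral>x. norm (f x - s j x) \<partial>lebesgue) < min e L"
    using lim by (rule order_tendstoD) (use e L in auto)
  then obtain j where j: "(\<integral>x. norm (f x - s j x) \<partial>lebesgue) < min e L"
    by (auto simp: eventually_sequentially)
  show thesis
  proof (rule that[of "s j"])
    have "integrable lebesgue (\<lambda>x. f x - s j x)"
      by (rule Bochner_Integration.integrable_bound[OF iM]) (use fm sm bound M2 in \<open>auto intro: order_trans\<close>)
    then have "(\<integral>\<^sup>+x. ennreal (norm (f x - s j x)) \<partial>lebesgue) = ennreal (\<integral>x. norm (f x - s j x) \<partial>lebesgue)"
      by (intro nn_integral_eq_integral) auto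
    also have "\<dots> \<le> ennreal L" using j by (intro ennreal_leI) simp
    finally have *: "(\<integral>\<^sup>+x. ennreal (norm (f x - s j x)) \<partial>lebesgue) \<le> ennreal L" .
    have "norm (f x - s j x) \<le> M2" for x using bound[of x j] M2 by (cases "norm x \<le> R") auto
    then have "lorentz_norm (ennreal r) 1 (\<lambda>x. f x - s j x) \<le> ennreal ((r + r / (r - 1)) * M2 powr (1 - 1 / r) * L powr (1 / r))"
      using fm sm r M2 L * by (intro lorentz_norm_one_le) auto
    also have "(r + r / (r - 1)) * M2 powr (1 - 1 / r) * L powr (1 / r) = e"
      using c by (simp add: L(2) flip: c_def)
    finally show "lorentz_norm (ennreal r) 1 (\<lambda>x. f x - s j x) \<le> ennreal e" .
  qed (use s j in auto)
qed

text \<open>The Lorentz claims are conditional so that the same truncation yields both plain density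
  among integrable functions and simultaneous approximation in both norms.\<close>

lemma truncation_approx:
  fixes f :: "real ^ 'n::finite \<Rightarrow> complex"
  assumes f: "integrable lebesgue f" and r: "r > 1" and e: "e > 0"
  obtains f' where "bounded_support f'" "f' \<in> borel_measurable lebesgue" "(\<integral>x. norm (f x - f' x) \<partial>lebesgue) < e"
    "f \<in> lorentz_space (ennreal r) 1 \<Longrightarrow> (\<lambda>x. f x - f' x) \<in> lorentz_space (ennreal r) 1"
    "f \<in> lorentz_space (ennreal r) 1 \<Longrightarrow> lorentz_norm (ennreal r) 1 (\<lambda>x. f x - f' x) \<le> ennreal e"
proof -
  have fm [measurable]: "f \<in> borel_measurable lebesgue" using f by auto
  \<comment> \<open>The region removed by truncation consists of far points and large values. It
    decreases to the empty set because \<open>f\<close> is finite at every point.\<close>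
  define E where "E N = - (cball 0 (real N) - {x. norm (f x) > real N})" for N
  have Em [measurable]: "E N \<in> sets lebesgue" for N
  proof -
    have "cball 0 (real N) - {x. norm (f x) > real N} \<in> sets lebesgue"
      by (intro sets.Diff level_set_measurable fm) auto
    then show ?thesis using sets.compl_sets[of _ lebesgue] by (auto simp: E_def Compl_eq_Diff_UNIV)
  qed
  have dec: "decseq E" unfolding decseq_def E_def by force
  have ex: "\<exists>N. \<forall>n\<ge>N. x \<notin> E n" for x
  proof -
    obtain N where N: "real N \<ge> max (norm x) (norm (f x))" using real_arch_simple by blast
    have "x \<notin> E n" if "n \<ge> N" for n using N that by (auto simp: E_def)
    then show ?thesis by blast
  qed
  then have int: "(\<Inter>N. E N) = {}" by blast
  have "(\<lambda>N. \<integral>x. norm (indicator (E N) x * f x) \<partial>lebesgue) \<longlonglongrightarrow> (\<integral>x. 0 \<partial>(lebesgue :: (real ^ 'n) measure))"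
  proof (rule integral_dominated_convergence)
    show "integrable lebesgue (\<lambda>x. norm (f x))" using f by simp
    show "AE x in lebesgue. (\<lambda>N. norm (indicator (E N) x * f x)) \<longlonglongrightarrow> 0"
    proof (rule AE_I2)
      fix x
      obtain N where N: "\<And>n. n \<ge> N \<Longrightarrow> x \<notin> E n" using ex by blast
      have "\<forall>\<^sub>F n in sequentially. norm (indicator (E n) x * f x) = 0"
        by (rule eventually_sequentiallyI[of N]) (use N in auto)
      then show "(\<lambda>N. norm (indicator (E N) x * f x)) \<longlonglongrightarrow> 0" by (rule tendsto_eventually)
    qed
  qed (auto simp: indicator_def)
  then have lim1: "\<forall>\<^sub>F N in sequentially. (\<integral>x. norm (indicator (E N) x * f x) \<partial>lebesgue) < e"
    using e by (auto dest: order_tendstoD(2)[of _ _ _ e])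
  have "\<forall>\<^sub>F N in sequentially. f \<in> lorentz_space (ennreal r) 1 \<longrightarrow> lorentz_norm (ennreal r) 1 (\<lambda>x. indicator (E N) x * f x) < ennreal e"
  proof (cases "f \<in> lorentz_space (ennreal r) 1")
    case True
    then have "(\<lambda>N. lorentz_norm (ennreal r) 1 (\<lambda>x. indicator (E N) x * f x)) \<longlonglongrightarrow> 0"
      using r by (intro lorentz_norm_one_tendsto_0 fm Em dec int) (auto simp: lorentz_space_def)
    then have "\<forall>\<^sub>F N in sequentially. lorentz_norm (ennreal r) 1 (\<lambda>x. indicator (E N) x * f x) < ennreal e"
      by (rule order_tendstoD) (use e in simp)
    then show ?thesis by eventually_elim simp
  qed auto
  then have "\<forall>\<^sub>F N in sequentially. (\<integral>x. norm (indicator (E N) x * f x) \<partial>lebesgue) < e \<and> 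
      (f \<in> lorentz_space (ennreal r) 1 \<longrightarrow> lorentz_norm (ennreal r) 1 (\<lambda>x. indicator (E N) x * f x) < ennreal e)"
    using lim1 by eventually_elim auto
  then obtain N where N: "(\<integral>x. norm (indicator (E N) x * f x) \<partial>lebesgue) < e"
    "f \<in> lorentz_space (ennreal r) 1 \<Longrightarrow> lorentz_norm (ennreal r) 1 (\<lambda>x. indicator (E N) x * f x) < ennreal e"
    by (auto simp: eventually_sequentially)
  define f' where "f' x = f x - indicator (E N) x * f x" for x
  have eq: "(\<lambda>x. f x - f' x) = (\<lambda>x. indicator (E N) x * f x)" by (simp add: f'_def)
  have eq': "f x - f' x = indicator (E N) x * f x" for x by (simp add: f'_def)
  have f': "norm x \<le> real N \<and> norm (f x) \<le> real N" if "f' x \<noteq> 0" for x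
    using that by (auto simp: f'_def E_def indicator_def split: if_splits)
  have gm: "(\<lambda>x. indicator (E N) x * f x) \<in> borel_measurable lebesgue" by measurable
  show thesis
  proof (rule that[of f'])
    have "norm (f' x) \<le> real N" for x
    proof (cases "f' x = 0")
      case False
      then have "x \<notin> E N" by (auto simp: f'_def)
      then have "f' x = f x" by (simp add: f'_def)
      with f'[OF False] show ?thesis by simp
    qed simp
    then show "bounded_support f'" using f' by (auto simp: bounded_support_def bounded_iff)
    show "f' \<in> borel_measurable lebesgue" unfolding f'_def[abs_def] by measurable
    show "(\<integral>x. norm (f x - f' x) \<partial>lebesgue) < e" unfolding eq' by (rule N)
    show "lorentz_norm (ennreal r) 1 (\<lambda>x. f x - f' x) \<le> ennreal e" if "f \<in> lorentz_space (ennreal r) 1"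
      unfolding eq' using N(2)[OF that] by simp
    show "(\<lambda>x. f x - f' x) \<in> lorentz_space (ennreal r) 1" if "f \<in> lorentz_space (ennreal r) 1"
      unfolding eq' lorentz_space_def using gm N(2)[OF that] by (auto intro: less_trans)
  qed
qed

section \<open>Extension of a weak-type operator from a dense class\<close>

lemma emeasure_level_add:
  fixes u v w :: "'a::euclidean_space \<Rightarrow> complex"
  assumes "u \<in> borel_measurable lebesgue" "v \<in> borel_measurable lebesgue"
    and "AE x in lebesgue. w x = u x + v x" and "k = l + m"
  shows "emeasure lebesgue {x. norm (w x) > k} \<le>
    emeasure lebesgue {x. norm (u x) > l} + emeasure lebesgue {x. norm (v x) > m}"
proof -
  note [simp] = level_set_measurable[OF assms(1)] level_set_measurable[OF assms(2)]
  have "emeasure lebesgue {x. norm (w x) > k} \<le> emeasure lebesgue ({x. norm (u x) > l} \<union> {x. norm (v x) > m})"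
  proof (rule emeasure_mono_AE)
    show "AE x in lebesgue. x \<in> {x. norm (w x) > k} \<longrightarrow> x \<in> {x. norm (u x) > l} \<union> {x. norm (v x) > m}"
      using assms(3)
    proof eventually_elim
      case (elim x)
      then show ?case using norm_triangle_ineq[of "u x" "v x"] \<open>k = l + m\<close> by auto
    qed
  qed (intro sets.Un; simp)
  also have "\<dots> \<le> emeasure lebesgue {x. norm (u x) > l} + emeasure lebesgue {x. norm (v x) > m}"
    by (rule emeasure_subadditive) simp_all
  finally show ?thesis .
qed

text \<open>The heights \<open>1 / Suc j\<close> exhaust the set where \<open>w\<close> is nonzero.
  All identities for the extension are reduced to this criterion.\<close>

lemma AE_zero_of_small_levels:
  fixes w :: "'a::euclidean_space \<Rightarrow> complex"
  assumes w: "w \<in> borel_measurable lebesgue"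
    and small: "\<And>l e. l > 0 \<Longrightarrow> e > 0 \<Longrightarrow> emeasure lebesgue {x. norm (w x) > l} \<le> ennreal e"
  shows "AE x in lebesgue. w x = 0"
proof -
  have "AE x in lebesgue. \<not> norm (w x) > 1 / real (Suc j)" for j
  proof -
    have "emeasure lebesgue {x. norm (w x) > 1 / real (Suc j)} \<le> 0"
      by (rule ennreal_le_epsilon) (use small[of "1 / real (Suc j)"] in auto)
    then have "{x. norm (w x) > 1 / real (Suc j)} \<in> null_sets lebesgue"
      using level_set_measurable[OF w] by (auto simp: null_sets_def)
    then show ?thesis by (auto dest: AE_not_in)
  qed
  then have "AE x in lebesgue. \<forall>j. \<not> norm (w x) > 1 / real (Suc j)" by (simp add: AE_all_countable)
  then show ?thesis
  proof eventually_elim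
    case (elim x)
    then show ?case using nat_approx_posE[of "norm (w x)"] by (metis zero_less_norm_iff)
  qed
qed

lemma L1_triangle:
  assumes "integrable lebesgue f" "integrable lebesgue g" "integrable lebesgue (h :: 'a::euclidean_space \<Rightarrow> complex)"
  shows "(\<integral>x. norm (f x - h x) \<partial>lebesgue) \<le> (\<integral>x. norm (f x - g x) \<partial>lebesgue) + (\<integral>x. norm (g x - h x) \<partial>lebesgue)"
proof -
  have "(\<integral>x. norm (f x - h x) \<partial>lebesgue) \<le> (\<integral>x. norm (f x - g x) + norm (g x - h x) \<partial>lebesgue)"
    using assms by (intro integral_mono) (auto intro: norm_diff_triangle_ineq[of "f _" "g _" "g _", simplified] 
       norm_diff_triangle_le order_refl)
  then show ?thesis using assms by simp
qed

text \<open>The passage to all integrable functions is independent of kernels and Lorentz spaces: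
  only the weak bound on a dense linear class enters, and \<open>T\<close> is used on
  \<open>S\<close> alone.\<close>

locale weak_type_extension =
  fixes T :: "(real ^ 'n::finite \<Rightarrow> complex) \<Rightarrow> (real ^ 'n \<Rightarrow> complex)"
    and S :: "(real ^ 'n \<Rightarrow> complex) set" and c :: real
  assumes c_pos: "c > 0"
    and S_integrable: "\<And>s. s \<in> S \<Longrightarrow> integrable lebesgue s"
    and S_add: "\<And>s t. s \<in> S \<Longrightarrow> t \<in> S \<Longrightarrow> (\<lambda>x. s x + t x) \<in> S"
    and S_scale: "\<And>a s. s \<in> S \<Longrightarrow> (\<lambda>x. a * s x) \<in> S"
    and T_linear: "linear_operator_on S T"
    and weak: "\<And>s l. s \<in> S \<Longrightarrow> l > 0 \<Longrightarrow>
      emeasure lebesgue {x. norm (T s x) > l} \<le> ennreal (c * (\<integral>x. norm (s x) \<partial>lebesgue) / l)"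
    and dense: "\<And>f e. integrable lebesgue f \<Longrightarrow> e > 0 \<Longrightarrow> \<exists>s\<in>S. (\<integral>x. norm (f x - s x) \<partial>lebesgue) < e"
begin

lemmas T_meas = linear_operator_onD(1)[OF T_linear]
  and T_add = linear_operator_onD(3)[OF T_linear]
  and T_scale = linear_operator_onD(4)[OF T_linear]

text \<open>Quantifying over all \<open>s\<close> instead of fixing an approximating sequence
  removes any question of independence of the sequence.\<close>

definition is_ext :: "(real ^ 'n \<Rightarrow> complex) \<Rightarrow> (real ^ 'n \<Rightarrow> complex) \<Rightarrow> bool" where
  "is_ext f u \<longleftrightarrow> u \<in> borel_measurable lebesgue \<and> (\<forall>s\<in>S. \<forall>l>0.
     emeasure lebesgue {x. norm (u x - T s x) > l} \<le> ennreal (c * (\<integral>x. norm (f x - s x) \<partial>lebesgue) / l))"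

definition ext :: "(real ^ 'n \<Rightarrow> complex) \<Rightarrow> (real ^ 'n \<Rightarrow> complex)" where
  "ext f = (SOME u. is_ext f u)"

lemma S_diff: "s \<in> S \<Longrightarrow> t \<in> S \<Longrightarrow> (\<lambda>x. s x - t x) \<in> S"
  using S_add[of s "\<lambda>x. - 1 * t x"] S_scale[of t "-1"] by simp

lemma T_diff:
  assumes "s \<in> S" "t \<in> S"
  shows "AE x in lebesgue. T (\<lambda>x. s x - t x) x = T s x - T t x"
  using T_add[OF assms(1) S_scale[OF assms(2), of "-1"]] T_scale[OF assms(2), of "-1"]
  by eventually_elim simp

lemma weak_diff:
  assumes "s \<in> S" "t \<in> S" "l > 0"
  shows "emeasure lebesgue {x. norm (T s x - T t x) > l} \<le> ennreal (c * (\<integral>x. norm (s x - t x) \<partial>lebesgue) / l)"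
proof -
  have "emeasure lebesgue {x. norm (T s x - T t x) > l} \<le> emeasure lebesgue {x. norm (T (\<lambda>x. s x - t x) x) > l}"
  proof (rule emeasure_mono_AE)
    show "AE x in lebesgue. x \<in> {x. norm (T s x - T t x) > l} \<longrightarrow> x \<in> {x. norm (T (\<lambda>x. s x - t x) x) > l}"
      using T_diff[OF assms(1,2)] by eventually_elim simp
  qed (intro level_set_measurable T_meas S_diff assms)
  also have "\<dots> \<le> ennreal (c * (\<integral>x. norm (s x - t x) \<partial>lebesgue) / l)"
    by (rule weak[OF S_diff[OF assms(1,2)] assms(3)])
  finally show ?thesis .
qed

text \<open>Along a rapidly approximating sequence the images converge almost everywhere, and
  Fatou's lemma carries the weak bound for the differences \<open>s j - t\<close> over to the
  limit.\<close>

lemma ex_is_ext: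
  assumes f: "integrable lebesgue f"
  shows "\<exists>u. is_ext f u"
proof -
  have "\<forall>j. \<exists>s. s \<in> S \<and> (\<integral>x. norm (f x - s x) \<partial>lebesgue) < (1/4) ^ j"
    using dense[OF f] by (auto simp: Bex_def)
  then obtain s where s: "\<And>j::nat. s j \<in> S" "\<And>j. (\<integral>x. norm (f x - s j x) \<partial>lebesgue) < (1/4) ^ j"
    by metis
  note sm = T_meas[OF s(1)]
  \<comment> \<open>Approximation at rate \<open>(1/4) ^ j\<close> against height
    \<open>(1/2) ^ j\<close> leaves measures of order \<open>(1/2) ^ j\<close>. These are summable
    for Borel-Cantelli, and so are the heights, which makes the telescoping series converge.\<close>
  define A where "A j = {x. norm (T (s (Suc j)) x - T (s j) x) > (1/2) ^ j}" for j
  have Am: "A j \<in> sets lebesgue" for j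
    unfolding A_def using sm by (intro level_set_measurable borel_measurable_diff)
  have Ab: "emeasure lebesgue (A j) \<le> ennreal (2 * c * (1/2) ^ j)" for j
  proof -
    have "(\<integral>x. norm (s (Suc j) x - s j x) \<partial>lebesgue) \<le> (\<integral>x. norm (s (Suc j) x - f x) \<partial>lebesgue) + (\<integral>x. norm (f x - s j x) \<partial>lebesgue)"
      using f s S_integrable by (intro L1_triangle) auto
    also have "\<dots> \<le> (1/4) ^ Suc j + (1/4) ^ j"
      using s(2)[of j] s(2)[of "Suc j"] by (simp add: norm_minus_commute)
    also have "\<dots> \<le> 2 * (1/4) ^ j" by simp
    finally have *: "(\<integral>x. norm (s (Suc j) x - s j x) \<partial>lebesgue) \<le> 2 * (1/4) ^ j" .
    have "emeasure lebesgue (A j) \<le> ennreal (c * (\<integral>x. norm (s (Suc j) x - s j x) \<partial>lebesgue) / (1/2) ^ j)"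
      unfolding A_def by (intro weak_diff s) simp
    also have "\<dots> \<le> ennreal (c * (2 * (1/4) ^ j) / (1/2) ^ j)"
      using * c_pos by (intro ennreal_leI divide_right_mono mult_left_mono) auto
    also have "c * (2 * (1/4) ^ j) / (1/2) ^ j = 2 * c * (1/2) ^ j"
      by (simp add: power_one_over field_simps flip: power_mult_distrib)
    finally show ?thesis .
  qed
  have "AE x in lebesgue. eventually (\<lambda>j. x \<in> space lebesgue - A j) sequentially"
  proof (rule borel_cantelli_AE1)
    show "emeasure lebesgue (A j) < \<infinity>" for j using Ab[of j] by (auto intro: le_less_trans)
    show "summable (\<lambda>j. measure lebesgue (A j))"
    proof (rule summable_comparison_test')
      show "summable (\<lambda>j. 2 * c * (1/2) ^ j)" by (intro summable_mult summable_geometric) simp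
      show "norm (measure lebesgue (A j)) \<le> 2 * c * (1/2) ^ j" for j
        using Ab[of j] c_pos by (simp add: measure_def enn2real_leI)
    qed
  qed (rule Am)
  then have conv: "AE x in lebesgue. (\<lambda>j. T (s j) x) \<longlonglongrightarrow> lim (\<lambda>j. T (s j) x)"
  proof eventually_elim
    case (elim x)
    have "summable (\<lambda>j. T (s (Suc j)) x - T (s j) x)"
    proof (rule summable_comparison_test_ev)
      show "summable (\<lambda>j. (1/2 :: real) ^ j)" by (intro summable_geometric) simp
      show "\<forall>\<^sub>F j in sequentially. norm (T (s (Suc j)) x - T (s j) x) \<le> (1/2) ^ j"
        using elim by eventually_elim (simp add: A_def not_less)
    qed
    then have "convergent (\<lambda>n. T (s n) x - T (s 0) x)"
      by (simp add: summable_iff_convergent sum_lessThan_telescope[of "\<lambda>i. T (s i) x"])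
    then have "convergent (\<lambda>n. (T (s n) x - T (s 0) x) + T (s 0) x)"
      by (rule convergent_add) (rule convergent_const)
    then show ?case by (simp add: convergent_LIMSEQ_iff)
  qed
  define u where "u x = lim (\<lambda>j. T (s j) x)" for x
  have um: "u \<in> borel_measurable lebesgue" unfolding u_def using sm by (rule borel_measurable_lim_metric)
  have "emeasure lebesgue {x. norm (u x - T t x) > l} \<le> ennreal (c * (\<integral>x. norm (f x - t x) \<partial>lebesgue) / l)"
    if t: "t \<in> S" and l: "l > 0" for t l
  proof -
    let ?B = "\<lambda>j. {x. norm (T (s j) x - T t x) > l}"
    have Bm: "?B j \<in> sets lebesgue" for j
      using sm T_meas[OF t] by (intro level_set_measurable borel_measurable_diff)
    have Um: "{x. norm (u x - T t x) > l} \<in> sets lebesgue"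
      using um T_meas[OF t] by (intro level_set_measurable borel_measurable_diff)
    have "emeasure lebesgue {x. norm (u x - T t x) > l} = (\<integral>\<^sup>+x. indicator {x. norm (u x - T t x) > l} x \<partial>lebesgue)"
      using Um by simp
    \<comment> \<open>A strict inequality at the limit persists for large \<open>j\<close>, so the
      limit set lies almost everywhere in the limit inferior of the sets
      \<open>?B j\<close>.\<close>
    also have "\<dots> \<le> (\<integral>\<^sup>+x. liminf (\<lambda>j. indicator (?B j) x) \<partial>lebesgue)"
    proof (rule nn_integral_mono_AE, use conv in eventually_elim)
      case (elim x)
      show ?case
      proof (cases "norm (u x - T t x) > l")
        case True
        have "(\<lambda>j. norm (T (s j) x - T t x)) \<longlonglongrightarrow> norm (u x - T t x)"
          using elim unfolding u_def by (intro tendsto_intros)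
        then have "\<forall>\<^sub>F j in sequentially. norm (T (s j) x - T t x) > l" using True by (rule order_tendstoD)
        then have "1 \<le> liminf (\<lambda>j. indicator (?B j) x :: ennreal)"
          by (intro Liminf_bounded) (auto elim: eventually_mono)
        then show ?thesis using True by simp
      qed simp
    qed
    also have "\<dots> \<le> liminf (\<lambda>j. \<integral>\<^sup>+x. indicator (?B j) x \<partial>lebesgue)"
      using Bm by (intro nn_integral_liminf) auto
    also have "\<dots> \<le> liminf (\<lambda>j. ennreal (c * ((\<integral>x. norm (f x - t x) \<partial>lebesgue) + (1/4) ^ j) / l))"
    proof (rule Liminf_mono, rule always_eventually, rule allI)
      fix j
      have "(\<integral>x. norm (s j x - t x) \<partial>lebesgue) \<le> (\<integral>x. norm (s j x - f x) \<partial>lebesgue) + (\<integral>x. norm (f x - t x) \<partial>lebesgue)"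
        using f s t S_integrable by (intro L1_triangle) auto
      also have "\<dots> \<le> (\<integral>x. norm (f x - t x) \<partial>lebesgue) + (1/4) ^ j"
        using s(2)[of j] by (simp add: norm_minus_commute)
      finally have *: "c * (\<integral>x. norm (s j x - t x) \<partial>lebesgue) / l \<le> c * ((\<integral>x. norm (f x - t x) \<partial>lebesgue) + (1/4) ^ j) / l"
        using c_pos l by (intro divide_right_mono mult_left_mono) auto
      have "(\<integral>\<^sup>+x. indicator (?B j) x \<partial>lebesgue) = emeasure lebesgue (?B j)" using Bm by simp
      also have "\<dots> \<le> ennreal (c * (\<integral>x. norm (s j x - t x) \<partial>lebesgue) / l)" by (rule weak_diff[OF s(1) t l])
      also have "\<dots> \<le> ennreal (c * ((\<integral>x. norm (f x - t x) \<partial>lebesgue) + (1/4) ^ j) / l)" using * by (rule ennreal_leI)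
      finally show "(\<integral>\<^sup>+x. indicator (?B j) x \<partial>lebesgue) \<le> ennreal (c * ((\<integral>x. norm (f x - t x) \<partial>lebesgue) + (1/4) ^ j) / l)" .
    qed
    also have "\<dots> = ennreal (c * (\<integral>x. norm (f x - t x) \<partial>lebesgue) / l)"
    proof (rule lim_imp_Liminf)
      have "(\<lambda>j. (1/4 :: real) ^ j) \<longlonglongrightarrow> 0" by (rule LIMSEQ_realpow_zero) auto
      then have "(\<lambda>j. c * ((\<integral>x. norm (f x - t x) \<partial>lebesgue) + (1/4) ^ j) / l) \<longlonglongrightarrow> c * ((\<integral>x. norm (f x - t x) \<partial>lebesgue) + 0) / l"
        using l by (intro tendsto_intros) auto
      then show "(\<lambda>j. ennreal (c * ((\<integral>x. norm (f x - t x) \<partial>lebesgue) + (1/4) ^ j) / l)) \<longlonglongrightarrow> ennreal (c * (\<integral>x. norm (f x - t x) \<partial>lebesgue) / l)"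
        by (intro tendsto_ennrealI) simp
    qed simp
    finally show ?thesis .
  qed
  then show ?thesis using um unfolding is_ext_def by blast
qed

lemma is_ext_ext: "integrable lebesgue f \<Longrightarrow> is_ext f (ext f)"
  unfolding ext_def by (rule someI_ex[OF ex_is_ext])

lemma ext_measurable: "integrable lebesgue f \<Longrightarrow> ext f \<in> borel_measurable lebesgue"
  using is_ext_ext by (simp add: is_ext_def)

lemma ext_approx:
  assumes "integrable lebesgue f" "s \<in> S" "l > 0"
  shows "emeasure lebesgue {x. norm (ext f x - T s x) > l} \<le> ennreal (c * (\<integral>x. norm (f x - s x) \<partial>lebesgue) / l)"
  using is_ext_ext[OF assms(1)] assms(2,3) by (simp add: is_ext_def)

text \<open>The predicate \<open>is_ext f\<close> sees \<open>f\<close> only through distances in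
  mean, so the choice operator receives the same predicate for both functions; hence equality
  everywhere.\<close>

lemma ext_AE_cong:
  assumes "integrable lebesgue f" "integrable lebesgue g" "AE x in lebesgue. f x = g x"
  shows "ext f = ext g"
proof -
  have "(\<integral>x. norm (f x - s x) \<partial>lebesgue) = (\<integral>x. norm (g x - s x) \<partial>lebesgue)" if "s \<in> S" for s
    using assms S_integrable[OF that] by (intro integral_cong_AE) auto
  then have "is_ext f u = is_ext g u" for u by (simp add: is_ext_def)
  then show ?thesis by (simp add: ext_def)
qed

lemma ext_add:
  assumes f: "integrable lebesgue f" and g: "integrable lebesgue g"
  shows "AE x in lebesgue. ext (\<lambda>y. f y + g y) x = ext f x + ext g x"
proof -
  let ?w = "\<lambda>x. ext (\<lambda>y. f y + g y) x - (ext f x + ext g x)"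
  have fg: "integrable lebesgue (\<lambda>y. f y + g y)" using f g by simp
  have "AE x in lebesgue. ?w x = 0"
  proof (rule AE_zero_of_small_levels)
    show "?w \<in> borel_measurable lebesgue"
      using ext_measurable f g fg by (intro borel_measurable_diff borel_measurable_add)
    fix l e :: real assume l: "l > 0" and e: "e > 0"
    \<comment> \<open>The three errors add up to \<open>12 * c * d / l\<close>, three quarters of
      \<open>e\<close>.\<close>
    define d where "d = e * l / (16 * c)"
    have d: "d > 0" using l e c_pos by (simp add: d_def)
    obtain s where s: "s \<in> S" "(\<integral>x. norm (f x - s x) \<partial>lebesgue) < d" using dense[OF f d] by blast
    obtain t where t: "t \<in> S" "(\<integral>x. norm (g x - t x) \<partial>lebesgue) < d" using dense[OF g d] by blast
    note m = ext_measurable[OF f] ext_measurable[OF g] ext_measurable[OF fg] T_meas[OF s(1)] T_meas[OF t(1)] T_meas[OF S_add[OF s(1) t(1)]]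
    let ?st = "\<lambda>y. s y + t y"
    have "(\<integral>x. norm ((f x + g x) - (s x + t x)) \<partial>lebesgue) \<le> (\<integral>x. norm (f x - s x) + norm (g x - t x) \<partial>lebesgue)"
      using f g S_integrable[OF s(1)] S_integrable[OF t(1)]
      by (intro integral_mono) (auto intro: norm_diff_triangle_ineq)
    also have "\<dots> = (\<integral>x. norm (f x - s x) \<partial>lebesgue) + (\<integral>x. norm (g x - t x) \<partial>lebesgue)"
      using f g S_integrable[OF s(1)] S_integrable[OF t(1)] by simp
    finally have st: "(\<integral>x. norm ((f x + g x) - (s x + t x)) \<partial>lebesgue) \<le> 2 * d" using s t by simp
    have b: "ennreal (c * I / (l / k)) \<le> ennreal (c * J / (l / k))" if "I \<le> J" "k > 0" for I J k
      using that c_pos l by (intro ennreal_leI divide_right_mono mult_left_mono) auto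
    have q: "emeasure lebesgue {x. norm (T u x - ext h x) > l / 4} \<le> ennreal (c * d / (l / 4))"
      if "integrable lebesgue h" "u \<in> S" "(\<integral>x. norm (h x - u x) \<partial>lebesgue) < d" for h u
    proof -
      have "emeasure lebesgue {x. norm (T u x - ext h x) > l / 4} \<le> ennreal (c * (\<integral>x. norm (h x - u x) \<partial>lebesgue) / (l / 4))"
        using ext_approx[OF that(1,2), of "l / 4"] l by (simp add: norm_minus_commute)
      also have "\<dots> \<le> ennreal (c * d / (l / 4))" using that(3) by (intro b) auto
      finally show ?thesis .
    qed
    have "emeasure lebesgue {x. norm (?w x) > l} \<le>
       emeasure lebesgue {x. norm (ext (\<lambda>y. f y + g y) x - T ?st x) > l / 2} + 
       emeasure lebesgue {x. norm ((T s x - ext f x) + (T t x - ext g x)) > l / 2}"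
    proof (rule emeasure_level_add)
      show "AE x in lebesgue. ?w x = (ext (\<lambda>y. f y + g y) x - T ?st x) + ((T s x - ext f x) + (T t x - ext g x))"
        using T_add[OF s(1) t(1)] by eventually_elim simp
    qed (use m in auto)
    also have "\<dots> \<le> ennreal (c * (2 * d) / (l / 2)) + (ennreal (c * d / (l / 4)) + ennreal (c * d / (l / 4)))"
    proof (rule add_mono)
      have "emeasure lebesgue {x. norm (ext (\<lambda>y. f y + g y) x - T ?st x) > l / 2} \<le> 
          ennreal (c * (\<integral>x. norm ((f x + g x) - (s x + t x)) \<partial>lebesgue) / (l / 2))"
        using l by (intro ext_approx[OF fg S_add[OF s(1) t(1)]]) simp
      also have "\<dots> \<le> ennreal (c * (2 * d) / (l / 2))" by (intro b st) simp
      finally show "emeasure lebesgue {x. norm (ext (\<lambda>y. f y + g y) x - T ?st x) > l / 2} \<le> ennreal (c * (2 * d) / (l / 2))" .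
      have "emeasure lebesgue {x. norm ((T s x - ext f x) + (T t x - ext g x)) > l / 2} \<le>
        emeasure lebesgue {x. norm (T s x - ext f x) > l / 4} + emeasure lebesgue {x. norm (T t x - ext g x) > l / 4}"
        by (rule emeasure_level_add) (use m in auto)
      also have "\<dots> \<le> ennreal (c * d / (l / 4)) + ennreal (c * d / (l / 4))"
        by (intro add_mono q f g s t)
      finally show "emeasure lebesgue {x. norm ((T s x - ext f x) + (T t x - ext g x)) > l / 2} \<le> ennreal (c * d / (l / 4)) + ennreal (c * d / (l / 4))" .
    qed
    also have "\<dots> = ennreal (12 * c * d / l)"
      using c_pos d l by (simp flip: ennreal_plus add: field_simps)
    also have "\<dots> \<le> ennreal e" using c_pos l e by (intro ennreal_leI) (simp add: d_def)
    finally show "emeasure lebesgue {x. norm (?w x) > l} \<le> ennreal e" .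
  qed
  then show ?thesis by eventually_elim simp
qed

lemma ext_scale:
  assumes f: "integrable lebesgue f"
  shows "AE x in lebesgue. ext (\<lambda>y. a * f y) x = a * ext f x"
proof -
  let ?w = "\<lambda>x. ext (\<lambda>y. a * f y) x - a * ext f x"
  have af: "integrable lebesgue (\<lambda>y. a * f y)" using f by simp
  \<comment> \<open>Adding 1 keeps \<open>b\<close> positive when \<open>a = 0\<close>.\<close>
  define b where "b = norm a + 1"
  have b: "b > 0" "norm a \<le> b" by (simp_all add: b_def add_nonneg_pos)
  have "AE x in lebesgue. ?w x = 0"
  proof (rule AE_zero_of_small_levels)
    show "?w \<in> borel_measurable lebesgue"
      using ext_measurable f af by (intro borel_measurable_diff borel_measurable_times borel_measurable_const)
    fix l e :: real assume l: "l > 0" and e: "e > 0"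
    \<comment> \<open>Both error bounds equal \<open>2 * c * b * d / l\<close>, together
      \<open>e\<close>.\<close>
    define d where "d = e * l / (4 * c * b)"
    have d: "d > 0" using l e c_pos b by (simp add: d_def)
    obtain s where s: "s \<in> S" "(\<integral>x. norm (f x - s x) \<partial>lebesgue) < d" using dense[OF f d] by blast
    let ?as = "\<lambda>y. a * s y"
    note m = ext_measurable[OF f] ext_measurable[OF af] T_meas[OF s(1)] T_meas[OF S_scale[OF s(1), of a]]
    have "(\<integral>x. norm (a * f x - a * s x) \<partial>lebesgue) = norm a * (\<integral>x. norm (f x - s x) \<partial>lebesgue)"
      by (simp add: norm_mult flip: right_diff_distrib)
    also have "\<dots> \<le> b * d" using b s(2) by (intro mult_mono) auto
    finally have as: "(\<integral>x. norm (a * f x - a * s x) \<partial>lebesgue) \<le> b * d" .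
    have "emeasure lebesgue {x. norm (?w x) > l} \<le>
       emeasure lebesgue {x. norm (ext (\<lambda>y. a * f y) x - T ?as x) > l / 2} + 
       emeasure lebesgue {x. norm (a * (T s x - ext f x)) > l / 2}"
    proof (rule emeasure_level_add)
      show "AE x in lebesgue. ?w x = (ext (\<lambda>y. a * f y) x - T ?as x) + a * (T s x - ext f x)"
        using T_scale[OF s(1), of a] by eventually_elim (simp add: algebra_simps)
    qed (use m in auto)
    also have "\<dots> \<le> ennreal (c * (b * d) / (l / 2)) + ennreal (c * d / (l / (2 * b)))"
    proof (rule add_mono)
      have "emeasure lebesgue {x. norm (ext (\<lambda>y. a * f y) x - T ?as x) > l / 2} \<le> ennreal (c * (\<integral>x. norm (a * f x - a * s x) \<partial>lebesgue) / (l / 2))"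
        using l by (intro ext_approx[OF af S_scale[OF s(1)]]) simp
      also have "\<dots> \<le> ennreal (c * (b * d) / (l / 2))"
        using as c_pos l by (intro ennreal_leI divide_right_mono mult_left_mono) auto
      finally show "emeasure lebesgue {x. norm (ext (\<lambda>y. a * f y) x - T ?as x) > l / 2} \<le> ennreal (c * (b * d) / (l / 2))" .
      have "emeasure lebesgue {x. norm (a * (T s x - ext f x)) > l / 2} \<le> emeasure lebesgue {x. norm (ext f x - T s x) > l / (2 * b)}"
      proof (rule emeasure_mono)
        show "{x. norm (a * (T s x - ext f x)) > l / 2} \<subseteq> {x. norm (ext f x - T s x) > l / (2 * b)}"
        proof clarify
          fix x assume "l / 2 < norm (a * (T s x - ext f x))"
          also have "\<dots> \<le> b * norm (ext f x - T s x)"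
            using b by (simp add: norm_mult norm_minus_commute mult_right_mono)
          finally show "l / (2 * b) < norm (ext f x - T s x)" using b by (simp add: field_simps)
        qed
      qed (use m in \<open>intro level_set_measurable borel_measurable_diff\<close>)
      also have "\<dots> \<le> ennreal (c * (\<integral>x. norm (f x - s x) \<partial>lebesgue) / (l / (2 * b)))"
        using l b by (intro ext_approx f s) auto
      also have "\<dots> \<le> ennreal (c * d / (l / (2 * b)))"
        using s(2) c_pos l b by (intro ennreal_leI divide_right_mono mult_left_mono) auto
      finally show "emeasure lebesgue {x. norm (a * (T s x - ext f x)) > l / 2} \<le> ennreal (c * d / (l / (2 * b)))" .
    qed
    also have "\<dots> = ennreal (4 * c * b * d / l)"
      using c_pos d l b by (simp flip: ennreal_plus add: field_simps)
    also have "\<dots> = ennreal e" using c_pos l e b by (simp add: d_def)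
    finally show "emeasure lebesgue {x. norm (?w x) > l} \<le> ennreal e" .
  qed
  then show ?thesis by eventually_elim simp
qed

lemma linear_operator_on_ext: "linear_operator_on L1_space ext"
  unfolding linear_operator_on_def L1_space_def
proof (intro conjI ballI allI impI)
  fix f g :: "real ^ 'n \<Rightarrow> complex"
  assume "f \<in> {f. integrable lebesgue f}" "g \<in> {f. integrable lebesgue f}" "AE x in lebesgue. f x = g x"
  then show "AE x in lebesgue. ext f x = ext g x" using ext_AE_cong[of f g] by simp
qed (simp_all add: ext_measurable ext_add ext_scale)

text \<open>For \<open>s = 0\<close> the defining inequality of the extension is the weak-type bound
  itself. Density provides a member of \<open>S\<close>, and scaling it by 0 puts the zero function
  into \<open>S\<close>.\<close>

lemma weak_type_ext: "weak_type_1_1 ext (ennreal c)"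
  unfolding weak_type_1_1_def
proof
  fix f :: "real ^ 'n \<Rightarrow> complex" assume "f \<in> L1_space"
  then have f: "integrable lebesgue f" by (simp add: L1_space_def)
  obtain s where "s \<in> S" using dense[OF f, of 1] by auto
  then have z: "(\<lambda>_. 0) \<in> S" using S_scale[of s 0] by simp
  have Tz: "AE x in lebesgue. T (\<lambda>_. 0) x = 0" by (rule linear_operator_zero[OF T_linear z])
  define I where "I = (\<integral>x. norm (f x) \<partial>lebesgue)"
  have I: "I \<ge> 0" by (simp add: I_def)
  have "lorentz_norm 1 \<infinity> (ext f) \<le> ennreal (c * I)"
  proof (rule weak_lorentz_one_le)
    fix l :: real assume l: "l > 0"
    have "emeasure lebesgue {x. norm (ext f x) > l} \<le> emeasure lebesgue {x. norm (ext f x - T (\<lambda>_. 0) x) > l}"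
    proof (rule emeasure_mono_AE)
      show "AE x in lebesgue. x \<in> {x. norm (ext f x) > l} \<longrightarrow> x \<in> {x. norm (ext f x - T (\<lambda>_. 0) x) > l}"
        using Tz by eventually_elim simp
    qed (intro level_set_measurable borel_measurable_diff ext_measurable f T_meas z)
    also have "\<dots> \<le> ennreal (c * I / l)" using ext_approx[OF f z l] by (simp add: I_def)
    finally show "emeasure lebesgue {x. norm (ext f x) > l} \<le> ennreal (c * I / l)" .
  qed (use I c_pos in simp)
  also have "\<dots> = ennreal c * (\<integral>\<^sup>+ x. ennreal (norm (f x)) \<partial>lebesgue)"
    using f c_pos I by (subst nn_integral_eq_integral) (auto simp: I_def ennreal_mult')
  finally show "lorentz_norm 1 \<infinity> (ext f) \<le> ennreal c * (\<integral>\<^sup>+ x. ennreal (norm (f x)) \<partial>lebesgue)" .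
qed

text \<open>The value \<open>ext f\<close> and the candidate \<open>v\<close> are both close in
  measure to the same \<open>T s\<close>, so they coincide. Agreement with the original operator is
  checked in this form.\<close>

lemma ext_unique:
  assumes f: "integrable lebesgue f" and v: "v \<in> borel_measurable lebesgue"
    and approx: "\<And>l e. l > 0 \<Longrightarrow> e > 0 \<Longrightarrow> \<exists>s\<in>S. (\<integral>x. norm (f x - s x) \<partial>lebesgue) < e \<and>
      emeasure lebesgue {x. norm (v x - T s x) > l} \<le> ennreal e"
  shows "AE x in lebesgue. ext f x = v x"
proof -
  have "AE x in lebesgue. ext f x - v x = 0"
  proof (rule AE_zero_of_small_levels)
    show "(\<lambda>x. ext f x - v x) \<in> borel_measurable lebesgue" by (intro borel_measurable_diff ext_measurable f v)
    fix l e :: real assume l: "l > 0" and e: "e > 0"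
    \<comment> \<open>The first bound absorbs the error of \<open>v\<close>, the second the error of
      \<open>ext f\<close>.\<close>
    define d where "d = min (e / 2) (e * l / (4 * c))"
    have d: "d > 0" "d \<le> e / 2" "c * d / (l / 2) \<le> e / 2" using l e c_pos by (auto simp: d_def min_def field_simps)
    obtain s where s: "s \<in> S" "(\<integral>x. norm (f x - s x) \<partial>lebesgue) < d" 
      "emeasure lebesgue {x. norm (v x - T s x) > l / 2} \<le> ennreal d" using approx[of "l / 2" d] l d by auto
    have "emeasure lebesgue {x. norm (ext f x - v x) > l} \<le> 
      emeasure lebesgue {x. norm (ext f x - T s x) > l / 2} + emeasure lebesgue {x. norm (T s x - v x) > l / 2}"
      by (rule emeasure_level_add) (use ext_measurable[OF f] T_meas[OF s(1)] v in auto)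
    also have "\<dots> \<le> ennreal (e / 2) + ennreal (e / 2)"
    proof (rule add_mono)
      have "c * (\<integral>x. norm (f x - s x) \<partial>lebesgue) / (l / 2) \<le> c * d / (l / 2)"
        using s(2) c_pos l by (intro divide_right_mono mult_left_mono) auto
      also note d(3)
      finally have *: "c * (\<integral>x. norm (f x - s x) \<partial>lebesgue) / (l / 2) \<le> e / 2" .
      show "emeasure lebesgue {x. norm (ext f x - T s x) > l / 2} \<le> ennreal (e / 2)"
        by (rule order_trans[OF ext_approx[OF f s(1)] ennreal_leI[OF *]]) (use l in simp)
      show "emeasure lebesgue {x. norm (T s x - v x) > l / 2} \<le> ennreal (e / 2)"
        using order_trans[OF s(3) ennreal_leI[OF d(2)]] by (simp add: norm_minus_commute)
    qed
    also have "\<dots> = ennreal e" using e by (simp flip: ennreal_plus)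
    finally show "emeasure lebesgue {x. norm (ext f x - v x) > l} \<le> ennreal e" .
  qed
  then show ?thesis by eventually_elim simp
qed

end

section \<open>The extension to all integrable functions\<close>

lemma linear_operator_on_subset:
  "linear_operator_on V T \<Longrightarrow> W \<subseteq> V \<Longrightarrow> linear_operator_on W T"
  unfolding linear_operator_on_def by blast

lemma weak_type_1_1_mono:
  "weak_type_1_1 T B \<Longrightarrow> B \<le> B' \<Longrightarrow> weak_type_1_1 T B'"
  unfolding weak_type_1_1_def by (meson mult_right_mono order_trans zero_le)

text \<open>An admissible constant strictly below \<open>?N + ennreal e\<close> exists by the
  definition of the infimum; no attainment has to be shown.\<close>

lemma lorentz_opnorm_attained_up_to:
  assumes "lorentz_opnorm p q p' q' T < \<infinity>" "e > 0"
  obtains B where "B \<ge> 0" "ennreal B \<le> lorentz_opnorm p q p' q' T + ennreal e"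
    "\<And>f. f \<in> lorentz_space p q \<Longrightarrow> lorentz_norm p' q' (T f) \<le> ennreal B * lorentz_norm p q f"
proof -
  let ?N = "lorentz_opnorm p q p' q' T"
  have "?N < ?N + ennreal e"
    using assms by (cases ?N) (auto simp flip: ennreal_plus simp: ennreal_less_iff)
  then obtain x where x: "x < ?N + ennreal e" 
    "x \<in> {ennreal C |C. C \<ge> 0 \<and> (\<forall>f\<in>lorentz_space p q. lorentz_norm p' q' (T f) \<le> ennreal C * lorentz_norm p q f)}"
    unfolding lorentz_opnorm_def Inf_less_iff by blast
  then show thesis using that less_imp_le by blast
qed

lemma dyadic_step_dense_L1:
  fixes f :: "real ^ 'n::finite \<Rightarrow> complex"
  assumes f: "integrable lebesgue f" and e: "e > 0"
  shows "\<exists>s\<in>dyadic_step. (\<integral>x. norm (f x - s x) \<partial>lebesgue) < e"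
proof -
  \<comment> \<open>The exponent \<open>2\<close> is an arbitrary value above 1; the estimates in
    mean do not depend on it.\<close>
  obtain f' where f': "bounded_support f'" "f' \<in> borel_measurable lebesgue" "(\<integral>x. norm (f x - f' x) \<partial>lebesgue) < e / 2"
    using truncation_approx[OF f, of 2 "e / 2"] e by auto
  obtain s where s: "s \<in> dyadic_step" "(\<integral>x. norm (f' x - s x) \<partial>lebesgue) < e / 2"
    using bounded_support_dyadic_approx[OF f'(2,1), of 2 "e / 2"] e by auto
  have "integrable lebesgue f'" "integrable lebesgue s"
    using f' s bounded_support_integrable dyadic_step_bounded_support dyadic_step_measurable by blast+
  then have "(\<integral>x. norm (f x - s x) \<partial>lebesgue) \<le> (\<integral>x. norm (f x - f' x) \<partial>lebesgue) + (\<integral>x. norm (f' x - s x) \<partial>lebesgue)"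
    using f by (intro L1_triangle)
  then show ?thesis using s f' by (intro bexI[of _ s]) auto
qed

text \<open>The operator is estimated separately on \<open>f - f'\<close> and \<open>f' - s\<close>,
  where \<open>f'\<close> is a truncation; this avoids a triangle inequality for the Lorentz
  quasi-norm. Chebyshev's inequality in the weak space turns small norms into small level
  sets.\<close>

lemma dyadic_step_joint_approx:
  fixes T :: "(real ^ 'n::finite \<Rightarrow> complex) \<Rightarrow> (real ^ 'n \<Rightarrow> complex)"
  assumes r: "r > 1" and T: "linear_operator_on (lorentz_space (ennreal r) 1) T"
    and B: "B \<ge> 0"
      "\<And>f. f \<in> lorentz_space (ennreal r) 1 \<Longrightarrow> lorentz_norm (ennreal r) \<infinity> (T f) \<le> ennreal B * lorentz_norm (ennreal r) 1 f"
    and f: "integrable lebesgue f" "f \<in> lorentz_space (ennreal r) 1" and l: "l > 0" and e: "e > 0"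
  shows "\<exists>s\<in>dyadic_step. (\<integral>x. norm (f x - s x) \<partial>lebesgue) < e \<and>
    emeasure lebesgue {x. norm (T f x - T s x) > l} \<le> ennreal e"
proof -
  let ?V = "lorentz_space (ennreal r) 1 :: (real ^ 'n \<Rightarrow> complex) set"
  \<comment> \<open>The second bound gives \<open>(B * d / (l / 2)) powr r \<le> e / 2\<close>, with
    \<open>B + 1\<close> guarding against \<open>B = 0\<close>; the first lets the two mean errors
    add up to less than \<open>e\<close>.\<close>
  define d where "d = min (e / 2) (l / 2 * (e / 2) powr (1 / r) / (B + 1))"
  have d: "d > 0" using e l B(1) by (simp add: d_def)
  have d2: "d \<le> e / 2" unfolding d_def by (rule min.cobounded1)
  have "d * (B + 1) \<le> l / 2 * (e / 2) powr (1 / r)"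
  proof -
    have "d \<le> l / 2 * (e / 2) powr (1 / r) / (B + 1)" by (simp add: d_def)
    then show ?thesis using B(1) by (simp add: field_simps)
  qed
  then have "B * d / (l / 2) \<le> (e / 2) powr (1 / r)" using l d by (simp add: field_simps)
  then have "(B * d / (l / 2)) powr r \<le> ((e / 2) powr (1 / r)) powr r"
    using r l d B(1) by (intro powr_mono2) auto
  then have Bd: "(B * d / (l / 2)) powr r \<le> e / 2" using r e by (simp add: powr_powr)
  have Tm: "T u \<in> borel_measurable lebesgue" if "u \<in> ?V" for u by (rule linear_operator_onD(1)[OF T that])
  have small: "emeasure lebesgue {x. norm (T u x) > l / 2} \<le> ennreal (e / 2)"
    if u: "u \<in> ?V" "lorentz_norm (ennreal r) 1 u \<le> ennreal d" for u
  proof -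
    have "lorentz_norm (ennreal r) \<infinity> (T u) \<le> ennreal B * ennreal d"
      using B(2)[OF u(1)] mult_left_mono[OF u(2), of "ennreal B"] by (auto intro: order_trans)
    then have "emeasure lebesgue {x. norm (T u x) > l / 2} \<le> ennreal ((B * d / (l / 2)) powr r)"
      using r l d B(1) by (intro emeasure_le_of_weak_lorentz Tm u) (auto simp: ennreal_mult')
    also have "\<dots> \<le> ennreal (e / 2)" using Bd by (rule ennreal_leI)
    finally show ?thesis .
  qed
  obtain f' where f': "bounded_support f'" "f' \<in> borel_measurable lebesgue" "(\<integral>x. norm (f x - f' x) \<partial>lebesgue) < d"
    "(\<lambda>x. f x - f' x) \<in> ?V" "lorentz_norm (ennreal r) 1 (\<lambda>x. f x - f' x) \<le> ennreal d"
    using truncation_approx[OF f(1) r d] f(2) by blast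
  obtain s where s: "s \<in> dyadic_step" "(\<integral>x. norm (f' x - s x) \<partial>lebesgue) < d"
     "lorentz_norm (ennreal r) 1 (\<lambda>x. f' x - s x) \<le> ennreal d"
    using bounded_support_dyadic_approx[OF f'(2,1) r d] by blast
  note sb = dyadic_step_bounded_support[OF s(1)] and sm = dyadic_step_measurable[OF s(1)]
  have "bounded_support (\<lambda>x. f' x + (-1) * s x)"
    by (intro bounded_support_add bounded_support_cmult f' sb) auto
  then have "bounded_support (\<lambda>x. f' x - s x)" by simp
  then have V: "f' \<in> ?V" "s \<in> ?V" "(\<lambda>x. f' x - s x) \<in> ?V"
    using f' sb sm r by (auto intro!: bounded_support_in_lorentz_space)
  have i: "integrable lebesgue f'" "integrable lebesgue s"
    using f' sb sm bounded_support_integrable by blast+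
  have "(\<integral>x. norm (f x - s x) \<partial>lebesgue) \<le> (\<integral>x. norm (f x - f' x) \<partial>lebesgue) + (\<integral>x. norm (f' x - s x) \<partial>lebesgue)"
    by (intro L1_triangle f i)
  then have "(\<integral>x. norm (f x - s x) \<partial>lebesgue) < e" using s f' d2 by linarith
  moreover have "emeasure lebesgue {x. norm (T f x - T s x) > l} \<le> ennreal e"
  proof -
    have "emeasure lebesgue {x. norm (T f x - T s x) > l} \<le>
      emeasure lebesgue {x. norm (T (\<lambda>x. f x - f' x) x) > l / 2} + emeasure lebesgue {x. norm (T (\<lambda>x. f' x - s x) x) > l / 2}"
    proof (rule emeasure_level_add)
      have "AE x in lebesgue. T f x = T f' x + T (\<lambda>x. f x - f' x) x"
        using linear_operator_onD(3)[OF T V(1) f'(4)] by simp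
      moreover have "AE x in lebesgue. T f' x = T s x + T (\<lambda>x. f' x - s x) x"
        using linear_operator_onD(3)[OF T V(2,3)] by simp
      ultimately show "AE x in lebesgue. T f x - T s x = T (\<lambda>x. f x - f' x) x + T (\<lambda>x. f' x - s x) x"
        by eventually_elim simp
    qed (simp_all add: Tm V f')
    also have "\<dots> \<le> ennreal (e / 2) + ennreal (e / 2)"
      by (intro add_mono small V f' s)
    also have "\<dots> = ennreal e" using e by (simp flip: ennreal_plus)
    finally show ?thesis .
  qed
  ultimately show ?thesis using s(1) by blast
qed

theorem theorem3p2:
  fixes r :: real
  assumes "1 < r"
  shows "\<exists>C::real. C > 0 \<and>
    (\<forall>(T :: (real ^ 'n::finite \<Rightarrow> complex) \<Rightarrow> (real ^ 'n \<Rightarrow> complex)) K A A'.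
       A > 0 \<longrightarrow> A' > 0 \<longrightarrow>
       linear_operator_on (lorentz_space (ennreal r) 1) T \<longrightarrow>
       associated_kernel (lorentz_space (ennreal r) 1) T K \<longrightarrow>
       size_condition K A \<longrightarrow>
       hoermander_condition K A' \<longrightarrow>
       lorentz_opnorm (ennreal r) 1 (ennreal r) \<infinity> T < \<infinity> \<longrightarrow>
       (\<exists>T' :: (real ^ 'n \<Rightarrow> complex) \<Rightarrow> (real ^ 'n \<Rightarrow> complex).
          linear_operator_on L1_space T' \<and>
          (\<forall>f \<in> L1_space \<inter> lorentz_space (ennreal r) 1. AE x in lebesgue. T' f x = T f x) \<and>
          weak_type_1_1 T'
            (ennreal C * (ennreal A' + lorentz_opnorm (ennreal r) 1 (ennreal r) \<infinity> T))))"
proof (intro exI[of _ "2 * cz_const r CARD('n)"] conjI allI impI)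
  show "2 * cz_const r CARD('n) > 0" using cz_const_pos[of r "CARD('n)"] by simp
  fix T :: "(real ^ 'n \<Rightarrow> complex) \<Rightarrow> (real ^ 'n \<Rightarrow> complex)" and K A A'
  assume A': "A' > 0" and T: "linear_operator_on (lorentz_space (ennreal r) 1) T"
    and K: "associated_kernel (lorentz_space (ennreal r) 1) T K" "hoermander_condition K A'"
    and fin: "lorentz_opnorm (ennreal r) 1 (ennreal r) \<infinity> T < \<infinity>"
  let ?N = "lorentz_opnorm (ennreal r) 1 (ennreal r) \<infinity> T"
  \<comment> \<open>A slack of \<open>A'\<close> is affordable because the target bound contains
    \<open>A'\<close> as well; it becomes the factor 2 in
    \<open>2 * cz_const r CARD('n)\<close>.\<close>
  obtain B where B: "B \<ge> 0" "ennreal B \<le> ?N + ennreal A'"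
    "\<And>f. f \<in> lorentz_space (ennreal r) 1 \<Longrightarrow> lorentz_norm (ennreal r) \<infinity> (T f) \<le> ennreal B * lorentz_norm (ennreal r) 1 f"
    by (rule lorentz_opnorm_attained_up_to[OF fin A']; rule that; assumption)
  define c where "c = cz_const r CARD('n) * (A' + B)"
  have c: "c > 0" using A' B(1) cz_const_pos[of r "CARD('n)"] by (simp add: c_def)
  have sub: "dyadic_step \<subseteq> (lorentz_space (ennreal r) 1 :: (real ^ 'n \<Rightarrow> complex) set)"
    using bounded_support_in_lorentz_space dyadic_step_bounded_support dyadic_step_measurable assms by blast
  interpret weak_type_extension T dyadic_step c
  proof
    fix s :: "real ^ 'n \<Rightarrow> complex" and l :: real assume s: "s \<in> dyadic_step" and l: "l > 0"
    obtain k where "step_function (1 / 2 ^ k) s" using s by (auto simp: dyadic_step_def)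
    from weak_type_step_function[OF assms T K A' B(1,3) this _ l]
    have "emeasure lebesgue {x. norm (T s x) > l} \<le> ennreal (c * (\<integral>x. norm (s x) \<partial>lborel) / l)"
      by (simp add: c_def)
    also have "(\<integral>x. norm (s x) \<partial>lborel) = (\<integral>x. norm (s x) \<partial>lebesgue)"
      using dyadic_step_borel[OF s] by (subst integral_completion) auto
    finally show "emeasure lebesgue {x. norm (T s x) > l} \<le> ennreal (c * (\<integral>x. norm (s x) \<partial>lebesgue) / l)" .
  next
    fix s :: "real ^ 'n \<Rightarrow> complex" assume "s \<in> dyadic_step"
    then show "integrable lebesgue s"
      by (intro bounded_support_integrable dyadic_step_bounded_support dyadic_step_measurable)
  qed (fact c dyadic_step_add dyadic_step_cmult linear_operator_on_subset[OF T sub] dyadic_step_dense_L1)+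
  show "\<exists>T'. linear_operator_on L1_space T' \<and>
    (\<forall>f\<in>L1_space \<inter> lorentz_space (ennreal r) 1. AE x in lebesgue. T' f x = T f x) \<and>
    weak_type_1_1 T' (ennreal (2 * cz_const r CARD('n)) * (ennreal A' + ?N))"
  proof (intro exI[of _ ext] conjI ballI)
    show "linear_operator_on L1_space ext" by (rule linear_operator_on_ext)
    show "AE x in lebesgue. ext f x = T f x" if "f \<in> L1_space \<inter> lorentz_space (ennreal r) 1" for f
      using that by (intro ext_unique dyadic_step_joint_approx[OF assms T B(1,3)] linear_operator_onD(1)[OF T])
        (auto simp: L1_space_def)
    have "ennreal c = ennreal (cz_const r CARD('n)) * (ennreal A' + ennreal B)"
      using cz_const_pos[of r "CARD('n)"] A' B(1) by (simp add: c_def ennreal_mult)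
    also have "\<dots> \<le> ennreal (cz_const r CARD('n)) * (2 * (ennreal A' + ?N))"
    proof (rule mult_left_mono)
      have "ennreal A' + ennreal B \<le> ennreal A' + (?N + ennreal A')" by (intro add_left_mono B)
      also have "\<dots> \<le> 2 * (ennreal A' + ?N)"
        by (simp add: mult_2 add_ac add_left_mono add_increasing)
      finally show "ennreal A' + ennreal B \<le> 2 * (ennreal A' + ?N)" .
    qed simp
    also have "\<dots> = ennreal (2 * cz_const r CARD('n)) * (ennreal A' + ?N)"
      by (simp add: ennreal_mult' algebra_simps)
    finally show "weak_type_1_1 ext (ennreal (2 * cz_const r CARD('n)) * (ennreal A' + ?N))"
      by (rule weak_type_1_1_mono[OF weak_type_ext])
  qed
qed

end
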